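(* Let $n\ge2$, $p\le n$, and consider the model, quasi-posterior, $\phi_{\Pi_\beta}$ and the sets $H(R)$ described in the context. Assume that for a positive constant $C_1$ and constants $\delta_1,\delta_2,\delta_3\in[0,1)$: (1) $\pi(\beta_0)\ge\sigma_0^{-p}\sqrt{\det(X^\top X)}\,n^{-C_1p}$; (2) with probability at least $1-\delta_3$, $\Pi_{\sigma^2}(\{\sigma^2:|\sigma^2/\sigma_0^2-1|>\delta_1\}\mid Y)\le\delta_2$; (3) $\phi_{\Pi_\beta}(1/\sqrt n)\le1/2$. Then there exist positive constants $c_1,c_2$ depending only on $C_1$ such that $$\Big\|\Pi_\beta(\cdot\mid Y)-\mathcal N(\hat\beta,\sigma_0^2(X^\top X)^{-1})\Big\|_{\mathrm{TV}}\le\phi_{\Pi_\beta}(c_1\sqrt{p\log n})+c_1\big(\delta_1p\log n+\delta_2+n^{-c_2p}\big)$$ whenever $Y\in H(c_1)$.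
   Context: Model: $Y=X\beta_0+r+\varepsilon$, with $Y\in\mathbb R^n$, $X$ a deterministic $n\times p$ matrix of full column rank $p\le n$, $\beta_0\in\mathbb R^p$, $r\in\mathbb R^n$ deterministic, and $\varepsilon$ with i.i.d. entries of mean zero and variance $\sigma_0^2\in(0,\infty)$. $\|\cdot\|$ is the Euclidean norm. Quasi-posterior: use the Gaussian quasi-likelihood $(2\pi\sigma^2)^{-n/2}e^{-\|Y-X\beta\|^2/(2\sigma^2)}$ with independent priors $\beta\sim\Pi_\beta$, $\Pi_\beta(d\beta)=\pi(\beta)d\beta$ (data-independent), and $\sigma^2\sim\Pi_{\sigma^2}$ supported in $(0,\infty)$ (possibly data-dependent). The quasi-posterior is $\Pi(d(\beta,\sigma^2)\mid Y)\propto(2\pi\sigma^2)^{-n/2}e^{-\|Y-X\beta\|^2/(2\sigma^2)}\pi(\beta)d\beta\,\Pi_{\sigma^2}(d\sigma^2)$, with marginals $\Pi_\beta(\cdot\mid Y)$ and $\Pi_{\sigma^2}(\cdot\mid Y)$. $\hat\beta=\hat\beta(Y)=(X^\top X)^{-1}X^\top Y$. For $R>0$: $B(R)=\{\beta\in\mathbb R^p:\|X(\beta-\beta_0)\|\le R\sigma_0\}$, $\phi_{\Pi_\beta}(R)=1-\inf_{\beta,\tilde\beta\in B(R)}\{\pi(\tilde\beta)/\pi(\beta)\}$, and $$H(R)=\{Y:\|X(\hat\beta(Y)-\beta_0)\|\le R\sqrt{p\log n}\,\sigma_0/4\}\cap\{Y:\Pi_{\sigma^2}(|\sigma^2/\sigma_0^2-1|>\delta_1\mid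 Y)\le\delta_2\}.$$ $\|P-Q\|_{\mathrm{TV}}=\sup_A|P(A)-Q(A)|$ is the total variation distance. Constants do not depend on $n$ or $p$. *)

theory Defs
  imports "HOL-Probability.Probability" "Jordan_Normal_Form.DL_Rank"
    "Jordan_Normal_Form.Gauss_Jordan_Elimination"
begin

text \<open>
  The dimensions \<open>n\<close> and \<open>p\<close> are quantified inside the main statement (the constants must not
  depend on them), so vectors and matrices are those of \<open>Jordan_Normal_Form\<close>, with explicit
  carriers. Several names also occur in \<open>HOL-Analysis\<close> and are therefore written qualified.
\<close>

type_synonym rvec = "real Matrix.vec"
type_synonym rmat = "real Matrix.mat"

definition vnorm :: "rvec \<Rightarrow> real" where
  "vnorm v = sqrt (Matrix.scalar_prod v v)"

definition gram :: "rmat \<Rightarrow> rmat" where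
  "gram X = Matrix.transpose_mat X * X"

text \<open>Unspecified for singular matrices.\<close>

definition mat_inv :: "rmat \<Rightarrow> rmat" where
  "mat_inv A = the (mat_inverse A)"

definition borel_vec :: "nat \<Rightarrow> rvec measure" where
  "borel_vec d = vimage_algebra (carrier_vec d) (\<lambda>v. \<lambda>i\<in>{..<d}. Matrix.vec_index v i)
     (Pi\<^sub>M {..<d} (\<lambda>_. borel))"

definition lborel_vec :: "nat \<Rightarrow> rvec measure" where
  "lborel_vec d = distr (Pi\<^sub>M {..<d} (\<lambda>_. lborel)) (borel_vec d) (Matrix.vec d)"

definition normal_vec :: "rvec \<Rightarrow> rmat \<Rightarrow> rvec measure" where
  "normal_vec m S = density (lborel_vec (dim_vec m))
     (\<lambda>x. ennreal (exp (- Matrix.scalar_prod (x - m) (mult_mat_vec (mat_inv S) (x - m)) / 2)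
        / sqrt ((2 * pi) ^ dim_vec m * Determinant.det S)))"

definition tv_dist :: "'a measure \<Rightarrow> 'a measure \<Rightarrow> real" where
  "tv_dist P Q = (SUP A\<in>sets P. \<bar>measure P A - measure Q A\<bar>)"


subsection \<open>The regression model\<close>

text \<open>\<open>N\<close> is the common law of the entries of the noise vector.\<close>

definition linear_model ::
  "nat \<Rightarrow> nat \<Rightarrow> rmat \<Rightarrow> rvec \<Rightarrow> rvec \<Rightarrow> real \<Rightarrow> real measure \<Rightarrow> bool" where
  "linear_model n p X \<beta>0 r \<sigma>0 N \<longleftrightarrow>
     X \<in> carrier_mat n p \<and> p \<le> n \<and> vec_space.rank n X = p \<and>
     \<beta>0 \<in> carrier_vec p \<and> r \<in> carrier_vec n \<and> 0 < \<sigma>0 \<and>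
     prob_space N \<and> sets N = sets borel \<and>
     integrable N (\<lambda>x. x) \<and> (\<integral>x. x \<partial>N) = 0 \<and>
     integrable N (\<lambda>x. x\<^sup>2) \<and> (\<integral>x. x\<^sup>2 \<partial>N) = \<sigma>0\<^sup>2"

text \<open>A vector with i.i.d. entries of law \<open>N\<close> has as its law the product of \<open>n\<close> copies of \<open>N\<close>.\<close>

definition noise :: "nat \<Rightarrow> real measure \<Rightarrow> (nat \<Rightarrow> real) measure" where
  "noise n N = Pi\<^sub>M {..<n} (\<lambda>_. N)"

definition response :: "rmat \<Rightarrow> rvec \<Rightarrow> rvec \<Rightarrow> (nat \<Rightarrow> real) \<Rightarrow> rvec" where
  "response X \<beta>0 r e = mult_mat_vec X \<beta>0 + r + Matrix.vec (dim_row X) e"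

definition lse :: "rmat \<Rightarrow> rvec \<Rightarrow> rvec" where
  "lse X y = mult_mat_vec (mat_inv (gram X)) (mult_mat_vec (Matrix.transpose_mat X) y)"


subsection \<open>Priors and the quasi-posterior\<close>

definition beta_prior :: "nat \<Rightarrow> (rvec \<Rightarrow> real) \<Rightarrow> rvec measure" where
  "beta_prior p \<pi> = density (lborel_vec p) (\<lambda>\<beta>. ennreal (\<pi> \<beta>))"

definition prior_density :: "nat \<Rightarrow> (rvec \<Rightarrow> real) \<Rightarrow> bool" where
  "prior_density p \<pi> \<longleftrightarrow>
     \<pi> \<in> borel_measurable (borel_vec p) \<and> (\<forall>\<beta>\<in>carrier_vec p. 0 \<le> \<pi> \<beta>) \<and>
     prob_space (beta_prior p \<pi>)"

text \<open>
  \<open>S y\<close> is the prior on \<open>\<sigma>\<^sup>2\<close> used when the data vector is \<open>y\<close>; the dependence on \<open>y\<close> is arbitrary.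
\<close>

definition variance_prior :: "nat \<Rightarrow> (rvec \<Rightarrow> real measure) \<Rightarrow> bool" where
  "variance_prior n S \<longleftrightarrow>
     (\<forall>y\<in>carrier_vec n. prob_space (S y) \<and> sets (S y) = sets borel \<and> measure (S y) {0<..} = 1)"

text \<open>The last argument \<open>s\<close> is the variance \<open>\<sigma>\<^sup>2\<close>.\<close>

definition quasi_lik :: "rmat \<Rightarrow> rvec \<Rightarrow> rvec \<Rightarrow> real \<Rightarrow> real" where
  "quasi_lik X y \<beta> s =
     (2 * pi * s) powr (- (real (dim_row X) / 2)) *
     exp (- (vnorm (y - mult_mat_vec X \<beta>))\<^sup>2 / (2 * s))"

definition joint_prior ::
  "rmat \<Rightarrow> (rvec \<Rightarrow> real) \<Rightarrow> (rvec \<Rightarrow> real measure) \<Rightarrow> rvec \<Rightarrow> (rvec \<times> real) measure" where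
  "joint_prior X \<pi> S y = beta_prior (dim_col X) \<pi> \<Otimes>\<^sub>M S y"

definition evidence ::
  "rmat \<Rightarrow> (rvec \<Rightarrow> real) \<Rightarrow> (rvec \<Rightarrow> real measure) \<Rightarrow> rvec \<Rightarrow> ennreal" where
  "evidence X \<pi> S y =
     (\<integral>\<^sup>+ (\<beta>, s). ennreal (quasi_lik X y \<beta> s) \<partial>joint_prior X \<pi> S y)"

text \<open>
  The normalising constant is always positive, but it can be infinite for exceptional data when
  \<open>S y\<close> has too much mass near \<open>0\<close>; then the quasi-posterior does not exist (and
  \<open>quasi_posterior\<close> below is the null measure).
\<close>

definition proper_posterior ::
  "rmat \<Rightarrow> (rvec \<Rightarrow> real) \<Rightarrow> (rvec \<Rightarrow> real measure) \<Rightarrow> rvec \<Rightarrow> bool" where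
  "proper_posterior X \<pi> S y \<longleftrightarrow> evidence X \<pi> S y < \<infinity>"

definition quasi_posterior ::
  "rmat \<Rightarrow> (rvec \<Rightarrow> real) \<Rightarrow> (rvec \<Rightarrow> real measure) \<Rightarrow> rvec \<Rightarrow> (rvec \<times> real) measure" where
  "quasi_posterior X \<pi> S y = density (joint_prior X \<pi> S y)
     (\<lambda>(\<beta>, s). ennreal (quasi_lik X y \<beta> s) / evidence X \<pi> S y)"

definition beta_posterior ::
  "rmat \<Rightarrow> (rvec \<Rightarrow> real) \<Rightarrow> (rvec \<Rightarrow> real measure) \<Rightarrow> rvec \<Rightarrow> rvec measure" where
  "beta_posterior X \<pi> S y = distr (quasi_posterior X \<pi> S y) (borel_vec (dim_col X)) fst"

definition variance_posterior ::
  "rmat \<Rightarrow> (rvec \<Rightarrow> real) \<Rightarrow> (rvec \<Rightarrow> real measure) \<Rightarrow> rvec \<Rightarrow> real measure" where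
  "variance_posterior X \<pi> S y = distr (quasi_posterior X \<pi> S y) borel snd"


subsection \<open>Localisation sets\<close>

definition Bset :: "rmat \<Rightarrow> rvec \<Rightarrow> real \<Rightarrow> real \<Rightarrow> rvec set" where
  "Bset X \<beta>0 \<sigma>0 R =
     {\<beta> \<in> carrier_vec (dim_col X). vnorm (mult_mat_vec X (\<beta> - \<beta>0)) \<le> R * \<sigma>0}"

text \<open>
  If \<open>\<pi>\<close> vanishes somewhere on the set but \<open>\<pi> \<beta>0 > 0\<close>, the infimum is \<open>0\<close> whatever value is
  given to quotients with zero denominator, so the convention \<open>x / 0 = 0\<close> is harmless.
\<close>

definition phi :: "rmat \<Rightarrow> rvec \<Rightarrow> real \<Rightarrow> (rvec \<Rightarrow> real) \<Rightarrow> real \<Rightarrow> real" where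
  "phi X \<beta>0 \<sigma>0 \<pi> R =
     1 - (INF (\<beta>, \<beta>')\<in>Bset X \<beta>0 \<sigma>0 R \<times> Bset X \<beta>0 \<sigma>0 R. \<pi> \<beta>' / \<pi> \<beta>)"

definition Hset ::
  "rmat \<Rightarrow> rvec \<Rightarrow> real \<Rightarrow> (rvec \<Rightarrow> real) \<Rightarrow> (rvec \<Rightarrow> real measure) \<Rightarrow> real \<Rightarrow> real \<Rightarrow> real \<Rightarrow> rvec set"
  where
  "Hset X \<beta>0 \<sigma>0 \<pi> S \<delta>1 \<delta>2 R =
     {y \<in> carrier_vec (dim_row X).
        vnorm (mult_mat_vec X (lse X y - \<beta>0))
          \<le> R * sqrt (real (dim_col X) * ln (real (dim_row X))) * \<sigma>0 / 4} \<inter>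
     {y \<in> carrier_vec (dim_row X).
        measure (variance_posterior X \<pi> S y) {s. \<bar>s / \<sigma>0\<^sup>2 - 1\<bar> > \<delta>1} \<le> \<delta>2}"

end

theory Submission
  imports Defs
begin

text \<open>
  Everything is read off the orthogonal decomposition of the residual at the least squares
  estimate: as a function of \<open>\<beta>\<close>, the quasi-likelihood at variance \<open>s\<close> is
  \<open>exp (- d(\<beta>) / (2 s))\<close> up to a factor free of \<open>\<beta>\<close>, where \<open>d(\<beta>) = \<parallel>X (\<beta> - \<beta>hat)\<parallel>\<^sup>2\<close>. Thus
  the posterior of \<open>\<beta>\<close> is a mixture, over the posterior of \<open>s\<close>, of Gaussian laws with covariance
  \<open>s (X\<^sup>T X)\<^sup>-\<^sup>1\<close> reweighted by the prior density \<open>\<pi>\<close>. With \<open>L = p ln n\<close>, the comparison takes place on the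
  ellipsoid \<open>d(\<beta>) \<le> w \<sigma>0\<^sup>2\<close>, \<open>w = (4 C1 + 8) L\<close>, which lies in the set \<open>B(c1 sqrt L)\<close> for
  \<open>c1 = 4 C1 + 9\<close> when \<open>y\<close> is in the localisation set.

  The total variation distance is bounded through a one-sided estimate: if a probability measure
  \<open>P\<close> satisfies \<open>P \<ge> \<kappa> Q\<close> on a set \<open>B\<close>, then its distance to \<open>Q\<close> is at most \<open>1 - \<kappa> + Q(B\<^sup>c)\<close>
  (\<open>tv_dist_le_of_minorization\<close>). Hence only a lower bound for the posterior is needed, and the
  tail of the posterior enters solely through its normalising constant.

  Fix \<open>s\<close> with \<open>|s / \<sigma>0\<^sup>2 - 1| \<le> \<delta>1 \<le> 1/2\<close> and put \<open>x = 1 - \<phi>\<close>, so that \<open>\<pi>(\<beta>) \<ge> x \<pi>(\<beta>')\<close> for all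
  \<open>\<beta>, \<beta>'\<close> in \<open>B(c1 sqrt L)\<close>. Splitting the normalising constant \<open>D\<close> of the conditional law at
  the ellipsoid gives \<open>x D \<le> \<pi>(\<beta>) Z + x exp (- w \<sigma>0\<^sup>2 / (2 s))\<close>, with \<open>Z\<close> the Gaussian integral. The
  lower bound on \<open>\<pi>(\<beta>0)\<close> says that \<open>\<pi>(\<beta>0) Z \<ge> exp (- C1 L)\<close>, so the second term is at most
  \<open>x t \<pi>(\<beta>0) Z \<le> t \<pi>(\<beta>) Z\<close> with \<open>t = exp (- L) = n\<^sup>-\<^sup>p\<close>. It follows that \<open>(x - t) D \<le> \<pi>(\<beta>) Z\<close>
  (\<open>prior_dominates_normaliser\<close>), without any loss from a small \<open>x\<close>. Replacing the
  variance \<open>s\<close> by \<open>\<sigma>0\<^sup>2\<close> costs the factor \<open>1 - \<eta>\<close> with \<open>\<eta> = \<delta>1 (p / 2 + w)\<close>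
  (\<open>gaussian_variance_perturbation\<close>). Integrating over the posterior of \<open>s\<close>, which gives mass at
  least \<open>1 - \<delta>2\<close> to these \<open>s\<close>, yields the minorisation with
  \<open>\<kappa> = (x - t) (1 - \<eta>) (1 - \<delta>2) \<ge> 1 - \<phi> - t - \<eta> - \<delta>2\<close>. The Gaussian mass outside the ellipsoid is again at
  most \<open>t\<close>, and \<open>\<eta> \<le> c1 \<delta>1 L\<close>, which is the claim with \<open>c2 = 1\<close>. In the remaining cases
  \<open>x < t\<close>, \<open>\<eta> > 1\<close> or \<open>\<delta>1 > 1/2\<close>, the right-hand side of the claim is at least \<open>1\<close>.
\<close>

section \<open>Positive definite forms and Gaussian integrals\<close>

text \<open>
  Forms are given by coefficient functions on \<open>nat\<close> rather than by matrices, so that the same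
  \<open>G\<close> serves in every dimension of the induction on \<open>d\<close>.
\<close>

definition quad :: "nat \<Rightarrow> (nat \<Rightarrow> nat \<Rightarrow> real) \<Rightarrow> (nat \<Rightarrow> real) \<Rightarrow> real" where
  "quad d G v = (\<Sum>i<d. \<Sum>j<d. G i j * v i * v j)"

text \<open>
  The Schur complement of the last diagonal entry: the form that remains after completing the
  square in the last variable.
\<close>

definition schur :: "nat \<Rightarrow> (nat \<Rightarrow> nat \<Rightarrow> real) \<Rightarrow> nat \<Rightarrow> nat \<Rightarrow> real" where
  "schur d G i j = G i j - G i d * G d j / G d d"

definition sym_pos_def :: "nat \<Rightarrow> (nat \<Rightarrow> nat \<Rightarrow> real) \<Rightarrow> bool" where
  "sym_pos_def d G \<longleftrightarrow> (\<forall>i<d. \<forall>j<d. G i j = G j i) \<and>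
     (\<forall>v. (\<exists>i<d. v i \<noteq> 0) \<longrightarrow> 0 < quad d G v)"

lemma quad_cong: "(\<And>i. i < d \<Longrightarrow> v i = w i) \<Longrightarrow> quad d G v = quad d G w"
  by (simp add: quad_def)

lemma quad_Suc_schur:
  assumes sym: "\<And>i j. i \<le> d \<Longrightarrow> j \<le> d \<Longrightarrow> G i j = G j i" and nz: "G d d \<noteq> 0"
  shows "quad (Suc d) G v =
    quad d (schur d G) v + G d d * (v d + (\<Sum>j<d. G d j * v j) / G d d)\<^sup>2"
proof -
  define b where "b = (\<Sum>j<d. G d j * v j)"
  have b': "(\<Sum>i<d. G i d * v i) = b"
    unfolding b_def by (intro sum.cong) (auto simp: sym)
  have "quad (Suc d) G v = quad d G v + (\<Sum>i<d. G i d * v i) * v d + (b * v d + G d d * v d * v d)"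
    by (simp add: quad_def sum.distrib sum_distrib_right sum_distrib_left b_def algebra_simps)
  also have "quad d G v = quad d (schur d G) v + (\<Sum>i<d. G i d * v i) * b / G d d"
    unfolding quad_def schur_def b_def
    by (simp add: sum_product sum_divide_distrib sum_subtractf algebra_simps)
  also have "quad d (schur d G) v + (\<Sum>i<d. G i d * v i) * b / G d d + (\<Sum>i<d. G i d * v i) * v d
      + (b * v d + G d d * v d * v d)
      = quad d (schur d G) v + G d d * (v d + b / G d d)\<^sup>2"
    unfolding b' using nz by (simp add: field_simps power2_eq_square)
  finally show ?thesis by (simp add: b_def)
qed

text \<open>
  The matrix factors into a unipotent block upper triangular matrix times the block lower
  triangular matrix with diagonal blocks \<open>schur d G\<close> and \<open>G d d\<close>.
\<close>

lemma det_Suc_schur: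
  assumes nz: "G d d \<noteq> 0"
  shows "Determinant.det (Matrix.mat (Suc d) (Suc d) (\<lambda>(i, j). G i j)) =
    G d d * Determinant.det (Matrix.mat d d (\<lambda>(i, j). schur d G i j))"
proof -
  define u where "u = Matrix.mat d 1 (\<lambda>(i, j). G i d / G d d)"
  define l where "l = Matrix.mat 1 d (\<lambda>(i, j). G d j)"
  define a where "a = Matrix.mat 1 1 (\<lambda>(i, j). G d d)"
  define S where "S = Matrix.mat d d (\<lambda>(i, j). schur d G i j)"
  define U where "U = four_block_mat (1\<^sub>m d) u (0\<^sub>m 1 d) (1\<^sub>m 1)"
  define L where "L = four_block_mat S (0\<^sub>m d 1) l a"
  have car: "u \<in> carrier_mat d 1" "l \<in> carrier_mat 1 d" "a \<in> carrier_mat 1 1" "S \<in> carrier_mat d d"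
    by (auto simp: u_def l_def a_def S_def)
  have carUL: "U \<in> carrier_mat (Suc d) (Suc d)" "L \<in> carrier_mat (Suc d) (Suc d)"
    using car by (auto simp: U_def L_def)
  have "U * L = four_block_mat (1\<^sub>m d * S + u * l) (1\<^sub>m d * 0\<^sub>m d 1 + u * a)
      (0\<^sub>m 1 d * S + 1\<^sub>m 1 * l) (0\<^sub>m 1 d * 0\<^sub>m d 1 + 1\<^sub>m 1 * a)"
    unfolding U_def L_def by (rule mult_four_block_mat) (use car in auto)
  also have "\<dots> = Matrix.mat (Suc d) (Suc d) (\<lambda>(i, j). G i j)" (is "?F = ?M")
  proof (rule eq_matI)
    fix i j assume "i < dim_row ?M" "j < dim_col ?M"
    then have ij: "i < Suc d" "j < Suc d" by auto
    show "?F $$ (i, j) = ?M $$ (i, j)"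
      using ij car nz
      by (auto simp: index_mat_four_block u_def l_def a_def S_def schur_def scalar_prod_def
            less_Suc_eq)
  qed (use car in auto)
  finally have "Determinant.det ?M = Determinant.det (U * L)" by simp
  also have "\<dots> = Determinant.det U * Determinant.det L"
    by (rule det_mult[OF carUL])
  also have "Determinant.det U = 1"
    unfolding U_def by (subst det_four_block_mat_lower_left_zero[of _ d _ 1]) (use car in auto)
  also have "Determinant.det L = Determinant.det S * Determinant.det a"
    unfolding L_def by (subst det_four_block_mat_upper_right_zero[of _ d _ 1]) (use car in auto)
  also have "Determinant.det a = G d d"
    by (subst det_single) (auto simp: a_def)
  finally show ?thesis by (simp add: S_def)
qed

text \<open>
  The Schur complement at \<open>v\<close> is the minimum of the full form over the last coordinate, and
  the minimum is attained.
\<close>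

lemma sym_pos_def_schur:
  assumes G: "sym_pos_def (Suc d) G"
  shows "0 < G d d" and "sym_pos_def d (schur d G)"
proof -
  have sym: "G i j = G j i" if "i \<le> d" "j \<le> d" for i j
    using G that by (auto simp: sym_pos_def_def less_Suc_eq_le)
  have pos: "0 < quad (Suc d) G v" if "\<exists>i<Suc d. v i \<noteq> 0" for v
    using G that by (auto simp: sym_pos_def_def)
  have "quad (Suc d) G (\<lambda>i. if i = d then 1 else 0) = G d d"
    by (simp add: quad_def if_distrib[where f="\<lambda>x. _ * x"] cong: if_cong)
  with pos[of "\<lambda>i. if i = d then 1 else 0"] show a: "0 < G d d" by auto
  show "sym_pos_def d (schur d G)"
    unfolding sym_pos_def_def
  proof (intro conjI allI impI)
    fix i j assume "i < d" "j < d"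
    then show "schur d G i j = schur d G j i"
      by (simp add: schur_def sym[of i j] sym[of i d] sym[of d j])
  next
    fix v :: "nat \<Rightarrow> real" assume v: "\<exists>i<d. v i \<noteq> 0"
    \<comment> \<open>the last coordinate that makes the completed square vanish\<close>
    define w where "w = v(d := - (\<Sum>j<d. G d j * v j) / G d d)"
    have "quad (Suc d) G w = quad d (schur d G) w + G d d * (w d + (\<Sum>j<d. G d j * w j) / G d d)\<^sup>2"
      by (rule quad_Suc_schur) (use sym a in auto)
    also have "(\<Sum>j<d. G d j * w j) = (\<Sum>j<d. G d j * v j)"
      by (simp add: w_def)
    also have "quad d (schur d G) w = quad d (schur d G) v"
      by (rule quad_cong) (simp add: w_def)
    also have "w d + (\<Sum>j<d. G d j * v j) / G d d = 0"
      by (simp add: w_def)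
    finally have "quad (Suc d) G w = quad d (schur d G) v" by simp
    moreover have "0 < quad (Suc d) G w"
    proof (rule pos)
      from v obtain i where "i < d" "v i \<noteq> 0" by blast
      then have "i < Suc d \<and> w i \<noteq> 0" by (simp add: w_def)
      then show "\<exists>i<Suc d. w i \<noteq> 0" by blast
    qed
    ultimately show "0 < quad d (schur d G) v" by simp
  qed
qed

lemma nn_integral_gaussian_1d:
  fixes a c :: real
  assumes a: "0 < a"
  shows "(\<integral>\<^sup>+t. ennreal (exp (- (a * (t - c)\<^sup>2) / 2)) \<partial>lborel) = ennreal (sqrt (2 * pi / a))"
proof -
  define s where "s = 1 / sqrt a"
  have s: "0 < s" "s\<^sup>2 = 1 / a" using a by (auto simp: s_def power_divide)
  have eq: "exp (- (a * (t - c)\<^sup>2) / 2) = sqrt (2 * pi / a) * normal_density c s t" for t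
    using a by (simp add: normal_density_def s(2) real_sqrt_divide field_simps)
  have "(\<integral>\<^sup>+t. ennreal (exp (- (a * (t - c)\<^sup>2) / 2)) \<partial>lborel)
      = (\<integral>\<^sup>+t. ennreal (sqrt (2 * pi / a)) * ennreal (normal_density c s t) \<partial>lborel)"
    unfolding eq by (intro nn_integral_cong ennreal_mult') (use a in simp)
  also have "\<dots> = ennreal (sqrt (2 * pi / a)) * (\<integral>\<^sup>+t. ennreal (normal_density c s t) \<partial>lborel)"
    by (rule nn_integral_cmult) simp
  also have "(\<integral>\<^sup>+t. ennreal (normal_density c s t) \<partial>lborel) = 1"
    using s by (simp add: nn_integral_eq_integral)
  finally show ?thesis by simp
qed

text \<open>
  Integrating out the last variable leaves the Gaussian integral of the Schur complement times a
  one-dimensional Gaussian integral, and the determinant splits in the same way. Allowing an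
  arbitrary centre \<open>m\<close> from the start saves the translation invariance of the measure: the
  shift is absorbed by the one-dimensional integrals.
\<close>

lemma gaussian_integral_quad:
  assumes "sym_pos_def d G"
  shows "0 < Determinant.det (Matrix.mat d d (\<lambda>(i, j). G i j)) \<and>
    (\<integral>\<^sup>+x. ennreal (exp (- quad d G (\<lambda>i. x i - m i) / 2)) \<partial>(Pi\<^sub>M {..<d} (\<lambda>_. lborel))) =
    ennreal (sqrt ((2 * pi) ^ d / Determinant.det (Matrix.mat d d (\<lambda>(i, j). G i j))))"
  using assms
proof (induction d arbitrary: G)
  case 0
  interpret product_sigma_finite "\<lambda>_::nat. lborel :: real measure" by standard
  have "Determinant.det (Matrix.mat 0 0 (\<lambda>(i, j). G i j)) = 1"
    by (rule det_dim_zero) simp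
  then show ?case by (simp add: quad_def PiM_empty nn_integral_count_space_finite)
next
  case (Suc d)
  interpret product_sigma_finite "\<lambda>_::nat. lborel :: real measure" by standard
  define a where "a = G d d"
  define S where "S = schur d G"
  define D where "D = Determinant.det (Matrix.mat d d (\<lambda>(i, j). S i j))"
  have a: "0 < a" and S: "sym_pos_def d S"
    using sym_pos_def_schur[OF Suc.prems] by (auto simp: a_def S_def)
  have sym: "G i j = G j i" if "i \<le> d" "j \<le> d" for i j
    using Suc.prems that by (auto simp: sym_pos_def_def less_Suc_eq_le)
  have det: "Determinant.det (Matrix.mat (Suc d) (Suc d) (\<lambda>(i, j). G i j)) = a * D"
    using det_Suc_schur[of G d] a by (simp add: a_def S_def D_def)
  have D: "0 < D" and IH: "(\<integral>\<^sup>+x. ennreal (exp (- quad d S (\<lambda>i. x i - m i) / 2)) \<partial>(Pi\<^sub>M {..<d} (\<lambda>_. lborel)))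
      = ennreal (sqrt ((2 * pi) ^ d / D))"
    using Suc.IH[OF S] by (auto simp: D_def)
  have meas: "(\<lambda>x. ennreal (exp (- quad k H (\<lambda>i. x i - m i) / 2)))
      \<in> borel_measurable (Pi\<^sub>M {..<k} (\<lambda>_. lborel))" for k H
    unfolding quad_def by measurable
  have "(\<integral>\<^sup>+x. ennreal (exp (- quad (Suc d) G (\<lambda>i. x i - m i) / 2)) \<partial>(Pi\<^sub>M {..<Suc d} (\<lambda>_. lborel)))
    = (\<integral>\<^sup>+x. (\<integral>\<^sup>+t. ennreal (exp (- quad (Suc d) G (\<lambda>i. (x(d := t)) i - m i) / 2)) \<partial>lborel)
         \<partial>(Pi\<^sub>M {..<d} (\<lambda>_. lborel)))"
    unfolding lessThan_Suc
    by (rule product_nn_integral_insert) (use meas[of "Suc d" G] in \<open>auto simp: lessThan_Suc\<close>)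
  also have "\<dots> = (\<integral>\<^sup>+x. ennreal (exp (- quad d S (\<lambda>i. x i - m i) / 2)) * ennreal (sqrt (2 * pi / a))
         \<partial>(Pi\<^sub>M {..<d} (\<lambda>_. lborel)))"
  proof (intro nn_integral_cong)
    fix x :: "nat \<Rightarrow> real"
    define c where "c = m d - (\<Sum>j<d. G d j * (x j - m j)) / a"
    have q: "quad (Suc d) G (\<lambda>i. (x(d := t)) i - m i) = quad d S (\<lambda>i. x i - m i) + a * (t - c)\<^sup>2" for t
    proof -
      have "quad (Suc d) G (\<lambda>i. (x(d := t)) i - m i) = quad d S (\<lambda>i. (x(d := t)) i - m i) +
          a * (((x(d := t)) d - m d) + (\<Sum>j<d. G d j * ((x(d := t)) j - m j)) / a)\<^sup>2"
        unfolding a_def S_def by (rule quad_Suc_schur) (use sym a in \<open>auto simp: a_def\<close>)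
      also have "quad d S (\<lambda>i. (x(d := t)) i - m i) = quad d S (\<lambda>i. x i - m i)"
        by (rule quad_cong) simp
      finally show ?thesis by (simp add: c_def algebra_simps)
    qed
    have "(\<integral>\<^sup>+t. ennreal (exp (- quad (Suc d) G (\<lambda>i. (x(d := t)) i - m i) / 2)) \<partial>lborel)
      = (\<integral>\<^sup>+t. ennreal (exp (- quad d S (\<lambda>i. x i - m i) / 2)) * ennreal (exp (- (a * (t - c)\<^sup>2) / 2)) \<partial>lborel)"
      unfolding q by (intro nn_integral_cong)
        (simp add: ennreal_mult[symmetric] exp_add[symmetric] diff_divide_distrib minus_divide_left[symmetric] add_divide_distrib)
    also have "\<dots> = ennreal (exp (- quad d S (\<lambda>i. x i - m i) / 2)) *
        (\<integral>\<^sup>+t. ennreal (exp (- (a * (t - c)\<^sup>2) / 2)) \<partial>lborel)"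
      by (rule nn_integral_cmult) simp
    finally show "(\<integral>\<^sup>+t. ennreal (exp (- quad (Suc d) G (\<lambda>i. (x(d := t)) i - m i) / 2)) \<partial>lborel)
      = ennreal (exp (- quad d S (\<lambda>i. x i - m i) / 2)) * ennreal (sqrt (2 * pi / a))"
      by (simp only: nn_integral_gaussian_1d[OF a])
  qed
  also have "\<dots> = ennreal (sqrt ((2 * pi) ^ d / D)) * ennreal (sqrt (2 * pi / a))"
    by (subst nn_integral_multc) (use meas[of d S] IH in auto)
  also have "\<dots> = ennreal (sqrt ((2 * pi) ^ Suc d / (a * D)))"
    using a D by (simp add: ennreal_mult'[symmetric] real_sqrt_mult[symmetric] mult.commute)
  finally show ?case using a D by (simp add: det)
qed

lemma quad_eq_scalar_prod:
  assumes "G \<in> carrier_mat d d" "v \<in> carrier_vec d"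
  shows "Matrix.scalar_prod v (mult_mat_vec G v) = quad d (\<lambda>i j. G $$ (i, j)) (\<lambda>i. v $ i)"
  using assms
  by (auto simp: quad_def scalar_prod_def mult_mat_vec_def sum_distrib_left atLeast0LessThan
        row_def mult_ac intro!: sum.cong)

text \<open>
  The characterisations of linear independence by the kernel require distinct columns; a repeated
  column would leave fewer than \<open>p\<close> vectors to span the column space.
\<close>

lemma full_column_rank_kernel:
  fixes X :: rmat
  assumes X: "X \<in> carrier_mat n p" and rk: "vec_space.rank n X = p"
    and v: "v \<in> carrier_vec p" and 0: "mult_mat_vec X v = 0\<^sub>v n"
  shows "v = 0\<^sub>v p"
proof (rule ccontr)
  assume nz: "v \<noteq> 0\<^sub>v p"
  interpret vec_space "TYPE(real)" n .
  have dist: "distinct (cols X)"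
  proof (rule ccontr)
    assume "\<not> distinct (cols X)"
    then have "card (set (cols X)) < p"
      using X card_length[of "cols X"] card_distinct[of "cols X"] by fastforce
    moreover obtain S where S: "maximal S (\<lambda>T. T \<subseteq> set (cols X) \<and> lin_indpt T)"
      using maximal_exists[of "(\<lambda>T. T \<subseteq> set (cols X) \<and> lin_indpt T)" "card (set (cols X))" "{}"]
      by (meson List.finite_set card_mono empty_iff empty_subsetI finite_lin_indpt2 rev_finite_subset)
    moreover have "S \<subseteq> set (cols X)" using S by (auto simp: maximal_def)
    then have "card S \<le> card (set (cols X))" by (intro card_mono) auto
    ultimately show False using rank_card_indpt[OF X S] rk by simp
  qed
  from full_rank_lin_indpt[OF X rk dist] lin_depI[OF X v nz 0 dist] show False by simp
qed

section \<open>Least squares and the Gram matrix\<close>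

lemma vnorm_sq: "(vnorm v)\<^sup>2 = (\<Sum>i<dim_vec v. (v $ i)\<^sup>2)"
proof -
  have "Matrix.scalar_prod v v = (\<Sum>i<dim_vec v. (v $ i)\<^sup>2)"
    by (simp add: scalar_prod_def atLeast0LessThan power2_eq_square)
  moreover have "0 \<le> (\<Sum>i<dim_vec v. (v $ i)\<^sup>2)" by (simp add: sum_nonneg)
  ultimately show ?thesis by (simp add: vnorm_def)
qed

lemma vnorm_sq_scalar_prod: "(vnorm v)\<^sup>2 = Matrix.scalar_prod v v"
  by (simp add: vnorm_sq scalar_prod_def atLeast0LessThan power2_eq_square[of "v $ _"])

lemma vnorm_eq_L2_set: "vnorm v = L2_set (\<lambda>i. v $ i) {..<dim_vec v}"
  by (simp add: vnorm_def L2_set_def scalar_prod_def atLeast0LessThan power2_eq_square)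

lemma vnorm_triangle:
  assumes "u \<in> carrier_vec n" "v \<in> carrier_vec n"
  shows "vnorm (u + v) \<le> vnorm u + vnorm v"
proof -
  have "vnorm (u + v) = L2_set (\<lambda>i. u $ i + v $ i) {..<n}"
    using assms by (auto simp: vnorm_eq_L2_set L2_set_def intro!: sum.cong)
  then show ?thesis
    using assms L2_set_triangle_ineq[of "\<lambda>i. u $ i" "\<lambda>i. v $ i" "{..<n}"]
    by (simp add: vnorm_eq_L2_set)
qed

lemma gram_carrier: "X \<in> carrier_mat n p \<Longrightarrow> gram X \<in> carrier_mat p p"
  by (simp add: gram_def)

lemma vnorm_mult_sq:
  assumes X: "X \<in> carrier_mat n p" and u: "u \<in> carrier_vec p"
  shows "(vnorm (mult_mat_vec X u))\<^sup>2 = quad p (\<lambda>i j. gram X $$ (i, j)) (\<lambda>i. u $ i)"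
proof -
  have Xu: "mult_mat_vec X u \<in> carrier_vec n" using X u by simp
  have "(vnorm (mult_mat_vec X u))\<^sup>2 = Matrix.scalar_prod (mult_mat_vec X u) (mult_mat_vec X u)"
    by (rule vnorm_sq_scalar_prod)
  also have "\<dots> = Matrix.scalar_prod u (mult_mat_vec (Matrix.transpose_mat X) (mult_mat_vec X u))"
    using transpose_vec_mult_scalar[OF X u Xu] X u Xu
      comm_scalar_prod[of u p "mult_mat_vec (Matrix.transpose_mat X) (mult_mat_vec X u)"] by simp
  also have "mult_mat_vec (Matrix.transpose_mat X) (mult_mat_vec X u) = mult_mat_vec (gram X) u"
    using X u by (simp add: gram_def assoc_mult_mat_vec[of _ p n _ p])
  also have "Matrix.scalar_prod u \<dots> = quad p (\<lambda>i j. gram X $$ (i, j)) (\<lambda>i. u $ i)"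
    by (rule quad_eq_scalar_prod[OF gram_carrier[OF X] u])
  finally show ?thesis .
qed

lemma gram_sym_pos_def:
  assumes X: "X \<in> carrier_mat n p" and rk: "vec_space.rank n X = p"
  shows "sym_pos_def p (\<lambda>i j. gram X $$ (i, j))"
  unfolding sym_pos_def_def
proof (intro conjI allI impI)
  fix i j assume "i < p" "j < p"
  then show "gram X $$ (i, j) = gram X $$ (j, i)"
    using X comm_scalar_prod[of "col X i" n "col X j"] by (simp add: gram_def)
next
  fix v :: "nat \<Rightarrow> real" assume v: "\<exists>i<p. v i \<noteq> 0"
  define u where "u = Matrix.vec p v"
  have u: "u \<in> carrier_vec p" by (simp add: u_def)
  have q: "quad p (\<lambda>i j. gram X $$ (i, j)) v = (vnorm (mult_mat_vec X u))\<^sup>2"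
    unfolding vnorm_mult_sq[OF X u] by (rule quad_cong) (simp add: u_def)
  have "u \<noteq> 0\<^sub>v p"
  proof
    assume "u = 0\<^sub>v p"
    then have "v i = 0" if "i < p" for i
      using that index_vec[of i p v] by (simp add: u_def)
    with v show False by blast
  qed
  then have nz: "mult_mat_vec X u \<noteq> 0\<^sub>v n"
    using full_column_rank_kernel[OF X rk u] by blast
  have "(vnorm (mult_mat_vec X u))\<^sup>2 \<noteq> 0"
  proof
    assume "(vnorm (mult_mat_vec X u))\<^sup>2 = 0"
    then have "(\<Sum>i<n. (mult_mat_vec X u $ i)\<^sup>2) = 0"
      using X by (simp add: vnorm_sq del: index_mult_mat_vec)
    then have "\<forall>i\<in>{..<n}. (mult_mat_vec X u $ i)\<^sup>2 = 0"
      by (subst (asm) sum_nonneg_eq_0_iff) auto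
    then have "mult_mat_vec X u = 0\<^sub>v n"
      using X by (intro eq_vecI) (auto simp del: index_mult_mat_vec)
    with nz show False by simp
  qed
  with q show "0 < quad p (\<lambda>i j. gram X $$ (i, j)) v" by simp
qed

lemma mat_inv_inverse:
  assumes A: "A \<in> carrier_mat d d" and nz: "Determinant.det A \<noteq> 0"
  shows "mat_inv A \<in> carrier_mat d d" "A * mat_inv A = 1\<^sub>m d" "mat_inv A * A = 1\<^sub>m d"
proof -
  have "mat_inverse A \<noteq> None"
  proof
    assume "mat_inverse A = None"
    from mat_inverse(1)[OF A this, of "()"] det_non_zero_imp_unit[OF A nz, of "()"]
    show False by (rule notE)
  qed
  then obtain B where B: "mat_inverse A = Some B" by (cases "mat_inverse A") simp_all
  have "mat_inv A = B" unfolding mat_inv_def B by simp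
  with mat_inverse(2)[OF A B]
  show "mat_inv A \<in> carrier_mat d d" "A * mat_inv A = 1\<^sub>m d" "mat_inv A * A = 1\<^sub>m d"
    by simp_all
qed

lemma mat_inv_unique:
  assumes A: "A \<in> carrier_mat d d" and B: "B \<in> carrier_mat d d"
    and AB: "A * B = 1\<^sub>m d"
  shows "mat_inv A = B"
proof -
  have "Determinant.det A * Determinant.det B = 1"
    using det_mult[OF A B] unfolding AB by simp
  then have nz: "Determinant.det A \<noteq> 0" by auto
  note inv = mat_inv_inverse[OF A nz]
  have "mat_inv A = mat_inv A * (A * B)" using inv(1) by (simp add: AB)
  also have "\<dots> = (mat_inv A * A) * B"
    by (rule assoc_mult_mat[OF inv(1) A B, symmetric])
  also have "\<dots> = B" using B by (simp add: inv(3))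
  finally show ?thesis .
qed

lemma lse_carrier:
  assumes "X \<in> carrier_mat n p" "Determinant.det (gram X) \<noteq> 0"
  shows "lse X y \<in> carrier_vec p"
proof (rule carrier_vecI)
  have "dim_row (mat_inv (gram X)) = p"
    by (rule carrier_matD(1)[OF mat_inv_inverse(1)[OF gram_carrier[OF assms(1)] assms(2)]])
  then show "dim_vec (lse X y) = p" unfolding lse_def dim_mult_mat_vec .
qed

text \<open>
  The normal equations make the least squares residual orthogonal to the column space of \<open>X\<close>.
\<close>

lemma residual_pythagoras:
  assumes X: "X \<in> carrier_mat n p" and nz: "Determinant.det (gram X) \<noteq> 0"
    and y: "y \<in> carrier_vec n" and \<beta>: "\<beta> \<in> carrier_vec p"
  shows "(vnorm (y - mult_mat_vec X \<beta>))\<^sup>2 =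
    (vnorm (y - mult_mat_vec X (lse X y)))\<^sup>2 + (vnorm (mult_mat_vec X (\<beta> - lse X y)))\<^sup>2"
proof -
  define b where "b = lse X y"
  define e where "e = y - mult_mat_vec X b"
  define u where "u = mult_mat_vec X (\<beta> - b)"
  have b: "b \<in> carrier_vec p" using lse_carrier[OF X nz] by (simp add: b_def)
  have e: "e \<in> carrier_vec n" and u: "u \<in> carrier_vec n" using X y b \<beta> by (auto simp: e_def u_def)
  note G = gram_carrier[OF X]
  note inv = mat_inv_inverse[OF G nz]
  define z where "z = mult_mat_vec (Matrix.transpose_mat X) y"
  have z: "z \<in> carrier_vec p" using X y by (simp add: z_def)
  have "mult_mat_vec (Matrix.transpose_mat X) e =
      z - mult_mat_vec (Matrix.transpose_mat X) (mult_mat_vec X b)"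
    unfolding e_def z_def using X y b by (intro mult_minus_distrib_mat_vec[of _ p n]) auto
  also have "mult_mat_vec (Matrix.transpose_mat X) (mult_mat_vec X b) = mult_mat_vec (gram X) b"
    using X b by (simp add: gram_def assoc_mult_mat_vec[of _ p n _ p])
  also have "\<dots> = mult_mat_vec (gram X * mat_inv (gram X)) z"
    using G inv(1) z by (simp add: b_def lse_def z_def[symmetric] assoc_mult_mat_vec[of _ p p _ p])
  also have "\<dots> = z" using z by (simp add: inv(2))
  finally have XTe: "mult_mat_vec (Matrix.transpose_mat X) e = 0\<^sub>v p" using z by simp
  have "Matrix.scalar_prod u e = 0"
  proof -
    have w: "\<beta> - b \<in> carrier_vec p" using \<beta> b by simp
    from XTe transpose_vec_mult_scalar[OF X w e] w have "Matrix.scalar_prod e u = 0"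
      by (simp add: u_def)
    then show ?thesis by (simp add: comm_scalar_prod[OF u e])
  qed
  then have orth: "(\<Sum>i<n. e $ i * u $ i) = 0"
    using e u by (simp add: scalar_prod_def atLeast0LessThan mult.commute)
  have "(vnorm (y - mult_mat_vec X \<beta>))\<^sup>2 = (\<Sum>i<n. (e $ i - u $ i)\<^sup>2)"
  proof -
    have "u = mult_mat_vec X \<beta> - mult_mat_vec X b"
      unfolding u_def by (rule mult_minus_distrib_mat_vec[OF X \<beta> b])
    then have "(y - mult_mat_vec X \<beta>) $ i = e $ i - u $ i" if "i < n" for i
      using that X y by (simp add: e_def del: index_mult_mat_vec)
    then show ?thesis using X y by (simp add: vnorm_sq del: index_mult_mat_vec index_minus_vec(1))
  qed
  also have "\<dots> = (\<Sum>i<n. (e $ i)\<^sup>2) + (\<Sum>i<n. (u $ i)\<^sup>2) - 2 * (\<Sum>i<n. e $ i * u $ i)"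
    by (simp add: power2_diff sum.distrib sum_subtractf sum_distrib_left mult.assoc)
  also have "\<dots> = (vnorm e)\<^sup>2 + (vnorm u)\<^sup>2"
    using e u by (simp add: orth vnorm_sq)
  finally show ?thesis by (simp add: e_def u_def b_def)
qed

section \<open>Gaussian measures on vectors\<close>

lemma space_borel_vec [simp]: "space (borel_vec d) = carrier_vec d"
  by (simp add: borel_vec_def)

lemma sets_lborel_vec [measurable_cong]: "sets (lborel_vec d) = sets (borel_vec d)"
  by (simp add: lborel_vec_def)

lemma space_lborel_vec [simp]: "space (lborel_vec d) = carrier_vec d"
  by (simp add: lborel_vec_def)

lemma measurable_vec_index [measurable]:
  assumes "i < d"
  shows "(\<lambda>v. v $ i) \<in> borel_measurable (borel_vec d)"
proof -
  have m: "(\<lambda>v. \<lambda>i\<in>{..<d}. v $ i) \<in> borel_vec d \<rightarrow>\<^sub>M Pi\<^sub>M {..<d} (\<lambda>_. borel :: real measure)"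
    unfolding borel_vec_def by (rule measurable_vimage_algebra1) (auto simp: space_PiM)
  have "(\<lambda>f. f i) \<circ> (\<lambda>v. \<lambda>i\<in>{..<d}. v $ i) \<in> borel_measurable (borel_vec d)"
    by (rule measurable_comp[OF m]) (use assms in simp)
  then show ?thesis using assms by (simp add: o_def)
qed

lemma measurable_vec [measurable]:
  "Matrix.vec d \<in> Pi\<^sub>M {..<d} (\<lambda>_. lborel :: real measure) \<rightarrow>\<^sub>M borel_vec d"
  unfolding borel_vec_def
proof (rule measurable_vimage_algebra2)
  have "(\<lambda>x. \<lambda>i\<in>{..<d}. x i) \<in> Pi\<^sub>M {..<d} (\<lambda>_. lborel :: real measure) \<rightarrow>\<^sub>M Pi\<^sub>M {..<d} (\<lambda>_. borel)"
    by measurable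
  also have "(\<lambda>x. \<lambda>i\<in>{..<d}. x i) = (\<lambda>x. \<lambda>i\<in>{..<d}. (Matrix.vec d x :: rvec) $ i)"
    by (intro ext) (simp add: restrict_def)
  finally show "(\<lambda>x. \<lambda>i\<in>{..<d}. (Matrix.vec d x :: rvec) $ i)
    \<in> Pi\<^sub>M {..<d} (\<lambda>_. lborel :: real measure) \<rightarrow>\<^sub>M Pi\<^sub>M {..<d} (\<lambda>_. borel)" .
qed simp

lemma measurable_vnorm_mult_sq:
  assumes X: "X \<in> carrier_mat n p" and m: "m \<in> carrier_vec p"
  shows "(\<lambda>\<beta>. (vnorm (mult_mat_vec X (\<beta> - m)))\<^sup>2) \<in> borel_measurable (borel_vec p)"
proof -
  have "(\<lambda>\<beta>. \<Sum>i<p. \<Sum>j<p. gram X $$ (i, j) * (\<beta> $ i - m $ i) * (\<beta> $ j - m $ j))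
      \<in> borel_measurable (borel_vec p)"
    by (intro borel_measurable_sum borel_measurable_times borel_measurable_diff
        borel_measurable_const measurable_vec_index) auto
  then show ?thesis
    by (rule measurable_cong[THEN iffD1, rotated])
      (use m in \<open>auto simp: vnorm_mult_sq[OF X] quad_def intro!: sum.cong\<close>)
qed

text \<open>
  The inverse covariance is the Gram matrix divided by the variance \<open>s\<close>.
\<close>

lemma gaussian_integral_vec:
  assumes X: "X \<in> carrier_mat n p" and rk: "vec_space.rank n X = p"
    and m: "m \<in> carrier_vec p" and s: "0 < s"
  shows "(\<integral>\<^sup>+\<beta>. ennreal (exp (- (vnorm (mult_mat_vec X (\<beta> - m)))\<^sup>2 / (2 * s))) \<partial>lborel_vec p) =
    ennreal (sqrt ((2 * pi * s) ^ p / Determinant.det (gram X)))"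
    (is "?I = _")
    and "0 < Determinant.det (gram X)"
proof -
  note G = gram_sym_pos_def[OF X rk] and gc = gram_carrier[OF X]
  have gm: "Matrix.mat p p (\<lambda>(i, j). gram X $$ (i, j)) = gram X"
    using gc by (intro eq_matI) auto
  show detpos: "0 < Determinant.det (gram X)"
    using conjunct1[OF gaussian_integral_quad[OF G]] unfolding gm .
  define H where "H = (\<lambda>i j. gram X $$ (i, j) / s)"
  have qH: "quad p H v = quad p (\<lambda>i j. gram X $$ (i, j)) v / s" for v
    by (simp add: quad_def H_def sum_divide_distrib)
  have H: "sym_pos_def p H"
    using G s unfolding sym_pos_def_def qH by (auto simp: H_def)
  have Hm: "Matrix.mat p p (\<lambda>(i, j). H i j) = smult_mat (1 / s) (gram X)"
    using gc by (intro eq_matI) (auto simp: H_def)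
  have detH: "Determinant.det (Matrix.mat p p (\<lambda>(i, j). H i j)) = Determinant.det (gram X) / s ^ p"
    unfolding Hm using gc by (simp add: power_divide)
  have meas: "(\<lambda>\<beta>. ennreal (exp (- (vnorm (mult_mat_vec X (\<beta> - m)))\<^sup>2 / (2 * s))))
      \<in> borel_measurable (borel_vec p)"
    using measurable_vnorm_mult_sq[OF X m] by measurable
  have "?I = (\<integral>\<^sup>+x. ennreal (exp (- (vnorm (mult_mat_vec X (Matrix.vec p x - m)))\<^sup>2 / (2 * s)))
      \<partial>(Pi\<^sub>M {..<p} (\<lambda>_. lborel)))"
    unfolding lborel_vec_def by (rule nn_integral_distr) (use meas in auto)
  also have "\<dots> = (\<integral>\<^sup>+x. ennreal (exp (- quad p H (\<lambda>i. x i - m $ i) / 2)) \<partial>(Pi\<^sub>M {..<p} (\<lambda>_. lborel)))"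
  proof (intro nn_integral_cong)
    fix x :: "nat \<Rightarrow> real"
    have "(vnorm (mult_mat_vec X (Matrix.vec p x - m)))\<^sup>2 =
        quad p (\<lambda>i j. gram X $$ (i, j)) (\<lambda>i. (Matrix.vec p x - m) $ i)"
      by (rule vnorm_mult_sq[OF X]) (use m in simp)
    also have "\<dots> = quad p (\<lambda>i j. gram X $$ (i, j)) (\<lambda>i. x i - m $ i)"
      by (rule quad_cong) (use m in simp)
    finally show "ennreal (exp (- (vnorm (mult_mat_vec X (Matrix.vec p x - m)))\<^sup>2 / (2 * s))) =
        ennreal (exp (- quad p H (\<lambda>i. x i - m $ i) / 2))"
      by (simp add: qH mult.commute)
  qed
  also have "\<dots> = ennreal (sqrt ((2 * pi) ^ p / (Determinant.det (gram X) / s ^ p)))"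
    using gaussian_integral_quad[OF H, of "\<lambda>i. m $ i"] unfolding detH by simp
  also have "(2 * pi) ^ p / (Determinant.det (gram X) / s ^ p) =
      (2 * pi * s) ^ p / Determinant.det (gram X)"
    by (simp add: power_mult_distrib)
  finally show "?I = ennreal (sqrt ((2 * pi * s) ^ p / Determinant.det (gram X)))" .
qed

text \<open>
  Written through the squared distance of the fitted values, the normal density has the same shape
  as the quasi-likelihood in \<open>\<beta>\<close>.
\<close>

lemma normal_vec_eq_density:
  assumes X: "X \<in> carrier_mat n p" and rk: "vec_space.rank n X = p"
    and m: "m \<in> carrier_vec p" and \<sigma>: "0 < \<sigma>"
  shows "normal_vec m (smult_mat (\<sigma>\<^sup>2) (mat_inv (gram X))) =
    density (lborel_vec p) (\<lambda>\<beta>. ennreal (exp (- (vnorm (mult_mat_vec X (\<beta> - m)))\<^sup>2 / (2 * \<sigma>\<^sup>2))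
      / sqrt ((2 * pi * \<sigma>\<^sup>2) ^ p / Determinant.det (gram X))))"
proof -
  note gc = gram_carrier[OF X]
  have detpos: "0 < Determinant.det (gram X)" by (rule gaussian_integral_vec(2)[OF X rk m \<sigma>])
  then have nz: "Determinant.det (gram X) \<noteq> 0" by simp
  note inv = mat_inv_inverse[OF gc nz]
  have dimm: "dim_vec m = p" using m by simp
  define S where "S = smult_mat (\<sigma>\<^sup>2) (mat_inv (gram X))"
  have S: "S \<in> carrier_mat p p" using inv by (simp add: S_def)
  have invS: "mat_inv S = smult_mat (1 / \<sigma>\<^sup>2) (gram X)"
  proof (rule mat_inv_unique[OF S])
    have "S * smult_mat (1 / \<sigma>\<^sup>2) (gram X) =
        smult_mat (1 / \<sigma>\<^sup>2) (smult_mat (\<sigma>\<^sup>2) (mat_inv (gram X) * gram X))"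
      unfolding S_def using inv(1) gc
      by (simp add: mult_smult_assoc_mat[of _ p p _ p] mult_smult_distrib[of _ p p _ p])
    also have "\<dots> = 1\<^sub>m p" using \<sigma> by (auto simp: inv(3) intro!: eq_matI)
    finally show "S * smult_mat (1 / \<sigma>\<^sup>2) (gram X) = 1\<^sub>m p" .
  qed (use gc in simp)
  have "Determinant.det (mat_inv (gram X)) * Determinant.det (gram X) = 1"
    using det_mult[OF inv(1) gc] by (simp add: inv(3))
  then have "Determinant.det (mat_inv (gram X)) = 1 / Determinant.det (gram X)"
    using nz by (simp add: field_simps)
  then have detS: "Determinant.det S = (\<sigma>\<^sup>2) ^ p / Determinant.det (gram X)"
    using inv(1) by (simp add: S_def)
  have qf: "Matrix.scalar_prod (\<beta> - m) (mult_mat_vec (mat_inv S) (\<beta> - m)) =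
      (vnorm (mult_mat_vec X (\<beta> - m)))\<^sup>2 / \<sigma>\<^sup>2" if "\<beta> \<in> carrier_vec p" for \<beta>
  proof -
    have u: "\<beta> - m \<in> carrier_vec p" using that m by simp
    have "mult_mat_vec (mat_inv S) (\<beta> - m) = smult_vec (1 / \<sigma>\<^sup>2) (mult_mat_vec (gram X) (\<beta> - m))"
      unfolding invS using gc u m
      by (intro eq_vecI) (auto simp: scalar_prod_def sum_divide_distrib intro!: sum.cong)
    then show ?thesis
      using u gc by (simp add: quad_eq_scalar_prod[OF gc u] vnorm_mult_sq[OF X u])
  qed
  show ?thesis
    unfolding normal_vec_def dimm S_def[symmetric] detS
  proof (rule density_cong)
    have mm[measurable]: "(\<lambda>\<beta>. (vnorm (mult_mat_vec X (\<beta> - m)))\<^sup>2) \<in> borel_measurable (lborel_vec p)"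
      using measurable_vnorm_mult_sq[OF X m] by (simp cong: measurable_cong_sets add: sets_lborel_vec)
    show "(\<lambda>\<beta>. ennreal (exp (- (vnorm (mult_mat_vec X (\<beta> - m)))\<^sup>2 / (2 * \<sigma>\<^sup>2))
        / sqrt ((2 * pi * \<sigma>\<^sup>2) ^ p / Determinant.det (gram X)))) \<in> borel_measurable (lborel_vec p)"
      by measurable
    have "(\<lambda>\<beta>. ennreal (exp (- ((vnorm (mult_mat_vec X (\<beta> - m)))\<^sup>2 / \<sigma>\<^sup>2) / 2) /
        sqrt ((2 * pi) ^ p * ((\<sigma>\<^sup>2) ^ p / Determinant.det (gram X))))) \<in> borel_measurable (lborel_vec p)"
      by measurable
    then show "(\<lambda>\<beta>. ennreal (exp (- Matrix.scalar_prod (\<beta> - m) (mult_mat_vec (mat_inv S) (\<beta> - m)) / 2) /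
        sqrt ((2 * pi) ^ p * ((\<sigma>\<^sup>2) ^ p / Determinant.det (gram X))))) \<in> borel_measurable (lborel_vec p)"
      by (rule measurable_cong[THEN iffD1, rotated]) (simp add: qf)
    show "AE \<beta> in lborel_vec p. ennreal (exp (- Matrix.scalar_prod (\<beta> - m) (mult_mat_vec (mat_inv S) (\<beta> - m)) / 2) /
        sqrt ((2 * pi) ^ p * ((\<sigma>\<^sup>2) ^ p / Determinant.det (gram X)))) =
      ennreal (exp (- (vnorm (mult_mat_vec X (\<beta> - m)))\<^sup>2 / (2 * \<sigma>\<^sup>2))
        / sqrt ((2 * pi * \<sigma>\<^sup>2) ^ p / Determinant.det (gram X)))"
      by (intro AE_I2) (simp add: qf power_mult_distrib mult.commute)
  qed
qed

section \<open>Total variation and oscillation of the prior\<close>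

text \<open>
  On \<open>B\<close> the measure \<open>Q\<close> exceeds \<open>P\<close> by at most \<open>(1 - \<kappa>) Q\<close>, which bounds
  \<open>Q A - P A\<close> for every \<open>A\<close>. Taking complements exchanges the roles of \<open>P\<close> and \<open>Q\<close>, since
  both have total mass \<open>1\<close>; no upper bound on \<open>P\<close> is needed.
\<close>

lemma tv_dist_le_of_minorization:
  assumes "prob_space P" "prob_space Q" and sets: "sets P = sets Q"
    and B: "B \<in> sets P" and \<kappa>: "\<kappa> \<le> 1"
    and minor: "\<And>A. A \<in> sets P \<Longrightarrow> A \<subseteq> B \<Longrightarrow> \<kappa> * measure Q A \<le> measure P A"
  shows "tv_dist P Q \<le> 1 - \<kappa> + measure Q (space Q - B)"
proof -
  interpret P: prob_space P by fact
  interpret Q: prob_space Q by fact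
  have space: "space P = space Q" by (rule sets_eq_imp_space_eq[OF sets])
  have lower: "measure Q A - measure P A \<le> 1 - \<kappa> + measure Q (space Q - B)" if A: "A \<in> sets P" for A
  proof -
    have "measure Q A \<le> measure Q (A \<inter> B) + measure Q (space Q - B)"
    proof -
      have "measure Q A \<le> measure Q ((A \<inter> B) \<union> (space Q - B))"
        by (rule Q.finite_measure_mono) (use A B sets sets.sets_into_space[of A Q] in auto)
      also have "\<dots> \<le> measure Q (A \<inter> B) + measure Q (space Q - B)"
        by (rule measure_Un_le) (use A B sets in auto)
      finally show ?thesis .
    qed
    moreover have "\<kappa> * measure Q (A \<inter> B) \<le> measure P A"
    proof -
      have "\<kappa> * measure Q (A \<inter> B) \<le> measure P (A \<inter> B)" by (rule minor) (use A B in auto)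
      also have "\<dots> \<le> measure P A" by (rule P.finite_measure_mono) (use A in auto)
      finally show ?thesis .
    qed
    moreover have "(1 - \<kappa>) * measure Q (A \<inter> B) \<le> (1 - \<kappa>) * 1"
      by (rule mult_left_mono) (use \<kappa> in auto)
    ultimately show ?thesis by (simp add: algebra_simps)
  qed
  show ?thesis
    unfolding tv_dist_def
  proof (rule cSUP_least)
    fix A assume A: "A \<in> sets P"
    have "measure P A - measure Q A = measure Q (space P - A) - measure P (space P - A)"
      using P.prob_compl[OF A] Q.prob_compl[of A] A sets space by simp
    with lower[OF A] lower[of "space P - A"] A
    show "\<bar>measure P A - measure Q A\<bar> \<le> 1 - \<kappa> + measure Q (space Q - B)" by auto
  qed auto
qed

lemma tv_dist_le_1:
  assumes "prob_space P" "prob_space Q"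
  shows "tv_dist P Q \<le> 1"
  unfolding tv_dist_def
proof (rule cSUP_least)
  interpret P: prob_space P by fact
  interpret Q: prob_space Q by fact
  fix A
  have "measure P A \<le> 1" "measure Q A \<le> 1" by auto
  then show "\<bar>measure P A - measure Q A\<bar> \<le> 1"
    using measure_nonneg[of P A] measure_nonneg[of Q A] by linarith
qed auto

text \<open>
  Multiplying out the quotient gives a form that also covers zeros of the prior density.
\<close>

lemma phi_ratio:
  assumes X: "X \<in> carrier_mat n p" and \<pi>: "prior_density p \<pi>"
    and \<beta>: "\<beta> \<in> Bset X \<beta>0 \<sigma>0 R" "\<beta>' \<in> Bset X \<beta>0 \<sigma>0 R"
  shows "(1 - phi X \<beta>0 \<sigma>0 \<pi> R) * \<pi> \<beta> \<le> \<pi> \<beta>'"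
proof -
  let ?B = "Bset X \<beta>0 \<sigma>0 R"
  have nonneg: "0 \<le> \<pi> b" if "b \<in> ?B" for b
    using \<pi> X that by (auto simp: prior_density_def Bset_def)
  have "(INF (b, b')\<in>?B \<times> ?B. \<pi> b' / \<pi> b) \<le> (case (\<beta>, \<beta>') of (b, b') \<Rightarrow> \<pi> b' / \<pi> b)"
  proof (rule cINF_lower)
    show "bdd_below ((\<lambda>(b, b'). \<pi> b' / \<pi> b) ` (?B \<times> ?B))"
      by (rule bdd_belowI[of _ 0]) (auto intro!: divide_nonneg_nonneg nonneg)
  qed (use \<beta> in auto)
  then have le: "1 - phi X \<beta>0 \<sigma>0 \<pi> R \<le> \<pi> \<beta>' / \<pi> \<beta>" by (simp add: phi_def)
  show ?thesis
  proof (cases "\<pi> \<beta> = 0")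
    case True then show ?thesis using nonneg[OF \<beta>(2)] by simp
  next
    case False
    then have "0 < \<pi> \<beta>" using nonneg[OF \<beta>(1)] by simp
    then show ?thesis using le by (simp add: pos_le_divide_eq)
  qed
qed

lemma center_in_Bset:
  assumes X: "X \<in> carrier_mat n p" and "\<beta>0 \<in> carrier_vec p" "0 \<le> R" "0 \<le> \<sigma>0"
  shows "\<beta>0 \<in> Bset X \<beta>0 \<sigma>0 R"
proof -
  have "\<beta>0 - \<beta>0 = 0\<^sub>v p" using assms by auto
  then have "mult_mat_vec X (\<beta>0 - \<beta>0) = 0\<^sub>v n" using X by (auto intro!: eq_vecI)
  then have "vnorm (mult_mat_vec X (\<beta>0 - \<beta>0)) = 0" by (simp add: vnorm_def)
  then show ?thesis using assms by (simp add: Bset_def)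
qed

lemma phi_range:
  assumes X: "X \<in> carrier_mat n p" and \<pi>: "prior_density p \<pi>" and \<beta>0: "\<beta>0 \<in> carrier_vec p"
    and pos: "0 < \<pi> \<beta>0" and R: "0 \<le> R" "0 \<le> \<sigma>0"
  shows "0 \<le> phi X \<beta>0 \<sigma>0 \<pi> R" "phi X \<beta>0 \<sigma>0 \<pi> R \<le> 1"
proof -
  have b: "\<beta>0 \<in> Bset X \<beta>0 \<sigma>0 R" by (rule center_in_Bset[OF X \<beta>0 R])
  have "(1 - phi X \<beta>0 \<sigma>0 \<pi> R) * \<pi> \<beta>0 \<le> 1 * \<pi> \<beta>0" using phi_ratio[OF X \<pi> b b] by simp
  then have "1 - phi X \<beta>0 \<sigma>0 \<pi> R \<le> 1" using pos by (rule mult_right_le_imp_le)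
  then show "0 \<le> phi X \<beta>0 \<sigma>0 \<pi> R" by simp
  have "0 \<le> \<pi> b" if "b \<in> Bset X \<beta>0 \<sigma>0 R" for b
    using \<pi> X that by (auto simp: prior_density_def Bset_def)
  then have "0 \<le> (INF (b, b')\<in>Bset X \<beta>0 \<sigma>0 R \<times> Bset X \<beta>0 \<sigma>0 R. \<pi> b' / \<pi> b)"
    using b by (intro cINF_greatest) (auto intro!: divide_nonneg_nonneg)
  then show "phi X \<beta>0 \<sigma>0 \<pi> R \<le> 1" by (simp add: phi_def)
qed

section \<open>The quasi-posterior as a mixture over the variance\<close>

locale gaussian_quasi_posterior =
  fixes n p :: nat and X :: rmat and \<pi> :: "rvec \<Rightarrow> real" and S :: "rvec \<Rightarrow> real measure" and y :: rvec
  assumes X: "X \<in> carrier_mat n p" and rk: "vec_space.rank n X = p"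
    and prior: "prior_density p \<pi>" and vprior: "variance_prior n S"
    and y: "y \<in> carrier_vec n" and proper: "proper_posterior X \<pi> S y"
begin

lemma dims_X [simp]: "dim_row X = n" "dim_col X = p"
  using X by auto

lemma det_gram_pos: "0 < Determinant.det (gram X)"
  using gaussian_integral_vec(2)[OF X rk zero_carrier_vec, of 1] by simp

definition bhat where "bhat = lse X y"

lemma bhat_carrier: "bhat \<in> carrier_vec p"
  unfolding bhat_def by (rule lse_carrier[OF X]) (use det_gram_pos in simp)

definition sq_dist :: "rvec \<Rightarrow> real" where
  "sq_dist \<beta> = (vnorm (mult_mat_vec X (\<beta> - bhat)))\<^sup>2"

lemma sq_dist_nonneg: "0 \<le> sq_dist \<beta>" by (simp add: sq_dist_def)

lemma sq_dist_measurable [measurable]: "sq_dist \<in> borel_measurable (borel_vec p)"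
  unfolding sq_dist_def[abs_def] by (rule measurable_vnorm_mult_sq[OF X bhat_carrier])

lemma pi_measurable [measurable]: "\<pi> \<in> borel_measurable (borel_vec p)"
  using prior by (simp add: prior_density_def)

lemma pi_nonneg: "\<beta> \<in> carrier_vec p \<Longrightarrow> 0 \<le> \<pi> \<beta>"
  using prior by (simp add: prior_density_def)

text \<open>
  The part of the quasi-likelihood that does not depend on \<open>\<beta>\<close>. It can be dropped when
  laws conditional on the variance are compared.
\<close>

definition lik_factor :: "real \<Rightarrow> real" where
  "lik_factor s = (2 * pi * s) powr (- (real n / 2)) * exp (- (vnorm (y - mult_mat_vec X bhat))\<^sup>2 / (2 * s))"

text \<open>
  The closed form of the Lebesgue integral of \<open>exp (- sq_dist \<beta> / (2 s))\<close> over \<open>\<beta>\<close>.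
\<close>

definition gauss_int :: "real \<Rightarrow> real" where
  "gauss_int s = sqrt ((2 * pi * s) ^ p / Determinant.det (gram X))"

lemma gauss_int_pos: "0 < s \<Longrightarrow> 0 < gauss_int s"
  using det_gram_pos by (simp add: gauss_int_def)

lemma quasi_lik_eq:
  assumes "\<beta> \<in> carrier_vec p"
  shows "quasi_lik X y \<beta> s = lik_factor s * exp (- sq_dist \<beta> / (2 * s))"
proof -
  have "(vnorm (y - mult_mat_vec X \<beta>))\<^sup>2 = (vnorm (y - mult_mat_vec X bhat))\<^sup>2 + sq_dist \<beta>"
    unfolding sq_dist_def bhat_def using residual_pythagoras[OF X _ y assms] det_gram_pos by simp
  then show ?thesis
    by (simp add: quasi_lik_def lik_factor_def add_divide_distrib diff_divide_distrib exp_add[symmetric] algebra_simps)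
qed

lemma lik_factor_nonneg: "0 \<le> lik_factor s" by (simp add: lik_factor_def)

lemma lik_factor_measurable [measurable]: "lik_factor \<in> borel_measurable borel"
  unfolding lik_factor_def[abs_def] by measurable

abbreviation "prior_m \<equiv> beta_prior p \<pi>"

sublocale prior: prob_space prior_m
  using prior by (simp add: prior_density_def)

sublocale var: prob_space "S y"
  using vprior y by (simp add: variance_prior_def)

sublocale joint: pair_sigma_finite prior_m "S y" ..

lemma sets_prior [measurable_cong]: "sets prior_m = sets (borel_vec p)"
  by (simp add: beta_prior_def sets_lborel_vec)

lemma space_prior [simp]: "space prior_m = carrier_vec p"
  by (simp add: beta_prior_def)

lemma sets_S [measurable_cong]: "sets (S y) = sets borel"
  using vprior y by (simp add: variance_prior_def)

lemma space_S [simp]: "space (S y) = UNIV"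
  using sets_eq_imp_space_eq[OF sets_S] by simp

text \<open>
  Up to normalisation, the posterior mass of \<open>A\<close> conditional on the variance \<open>s\<close>.
\<close>

definition lik_mass :: "rvec set \<Rightarrow> real \<Rightarrow> ennreal" where
  "lik_mass A s = (\<integral>\<^sup>+\<beta>. ennreal (exp (- sq_dist \<beta> / (2 * s))) * indicator A \<beta> \<partial>prior_m)"

lemma nn_integral_prior:
  assumes [measurable]: "f \<in> borel_measurable (borel_vec p)"
  shows "(\<integral>\<^sup>+\<beta>. f \<beta> \<partial>prior_m) = (\<integral>\<^sup>+\<beta>. ennreal (\<pi> \<beta>) * f \<beta> \<partial>lborel_vec p)"
  unfolding beta_prior_def by (rule nn_integral_density) measurable

lemma lik_mass_lebesgue:
  assumes [measurable]: "A \<in> sets (borel_vec p)"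
  shows "lik_mass A s = (\<integral>\<^sup>+\<beta>. ennreal (\<pi> \<beta>) * (ennreal (exp (- sq_dist \<beta> / (2 * s))) * indicator A \<beta>) \<partial>lborel_vec p)"
  unfolding lik_mass_def by (rule nn_integral_prior) measurable

lemma lik_mass_le_1: "0 < s \<Longrightarrow> lik_mass A s \<le> 1"
proof -
  assume s: "0 < s"
  have "lik_mass A s \<le> (\<integral>\<^sup>+\<beta>. 1 \<partial>prior_m)"
    unfolding lik_mass_def
  proof (rule nn_integral_mono)
    fix \<beta>
    have "- sq_dist \<beta> / (2 * s) \<le> 0" using sq_dist_nonneg[of \<beta>] s by (simp add: divide_nonpos_pos)
    then have "exp (- sq_dist \<beta> / (2 * s)) \<le> 1" by simp
    then show "ennreal (exp (- sq_dist \<beta> / (2 * s))) * indicator A \<beta> \<le> 1"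
      by (auto simp: indicator_def ennreal_le_1)
  qed
  then show ?thesis using prior.emeasure_space_1 by simp
qed

lemma lik_measurable:
  "(\<lambda>(\<beta>, s). ennreal (quasi_lik X y \<beta> s)) \<in> borel_measurable (prior_m \<Otimes>\<^sub>M S y)"
proof -
  have "(\<lambda>z. ennreal (lik_factor (snd z) * exp (- sq_dist (fst z) / (2 * snd z)))) \<in> borel_measurable (prior_m \<Otimes>\<^sub>M S y)"
    by measurable
  then show ?thesis
    by (rule measurable_cong[THEN iffD1, rotated])
      (auto simp: space_pair_measure quasi_lik_eq)
qed

abbreviation "E \<equiv> evidence X \<pi> S y"

lemma lik_rectangle:
  assumes A: "A \<in> sets (borel_vec p)" and C: "C \<in> sets borel"
  shows "(\<integral>\<^sup>+z. ennreal (quasi_lik X y (fst z) (snd z)) * indicator (A \<times> C) z \<partial>(prior_m \<Otimes>\<^sub>M S y)) =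
    (\<integral>\<^sup>+s. ennreal (lik_factor s) * lik_mass A s * indicator C s \<partial>S y)"
proof -
  have [measurable]: "A \<in> sets prior_m" "C \<in> sets (S y)" using A C sets_prior sets_S by auto
  have m: "(\<lambda>z. ennreal (quasi_lik X y (fst z) (snd z)) * indicator (A \<times> C) z) \<in> borel_measurable (prior_m \<Otimes>\<^sub>M S y)"
    using lik_measurable by (simp add: case_prod_beta') 
  have "(\<integral>\<^sup>+z. ennreal (quasi_lik X y (fst z) (snd z)) * indicator (A \<times> C) z \<partial>(prior_m \<Otimes>\<^sub>M S y)) =
    (\<integral>\<^sup>+s. \<integral>\<^sup>+\<beta>. ennreal (quasi_lik X y \<beta> s) * indicator (A \<times> C) (\<beta>, s) \<partial>prior_m \<partial>S y)"
    using joint.nn_integral_snd[OF m[unfolded case_prod_beta'[symmetric]]] by simp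
  also have "\<dots> = (\<integral>\<^sup>+s. ennreal (lik_factor s) * lik_mass A s * indicator C s \<partial>S y)"
  proof (rule nn_integral_cong)
    fix s
    have "(\<integral>\<^sup>+\<beta>. ennreal (quasi_lik X y \<beta> s) * indicator (A \<times> C) (\<beta>, s) \<partial>prior_m) =
      (\<integral>\<^sup>+\<beta>. (ennreal (lik_factor s) * indicator C s) * (ennreal (exp (- sq_dist \<beta> / (2 * s))) * indicator A \<beta>) \<partial>prior_m)"
      by (intro nn_integral_cong)
        (auto simp: quasi_lik_eq ennreal_mult' lik_factor_nonneg indicator_def)
    also have "\<dots> = (ennreal (lik_factor s) * indicator C s) * lik_mass A s"
      unfolding lik_mass_def by (rule nn_integral_cmult) measurable
    finally show "(\<integral>\<^sup>+\<beta>. ennreal (quasi_lik X y \<beta> s) * indicator (A \<times> C) (\<beta>, s) \<partial>prior_m) =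
      ennreal (lik_factor s) * lik_mass A s * indicator C s" by (simp add: mult_ac)
  qed
  finally show ?thesis .
qed

lemma evidence_eq: "E = (\<integral>\<^sup>+s. ennreal (lik_factor s) * lik_mass (carrier_vec p) s \<partial>S y)"
proof -
  have "carrier_vec p \<in> sets (borel_vec p)" using sets.top[of "borel_vec p"] by simp
  note R = lik_rectangle[OF this, of UNIV]
  have "E = (\<integral>\<^sup>+z. ennreal (quasi_lik X y (fst z) (snd z)) * indicator (carrier_vec p \<times> UNIV) z \<partial>(prior_m \<Otimes>\<^sub>M S y))"
    unfolding evidence_def joint_prior_def dims_X
    by (intro nn_integral_cong) (auto simp: space_pair_measure)
  then show ?thesis using R by simp
qed

lemma lik_mass_nonzero: "0 < s \<Longrightarrow> lik_mass (carrier_vec p) s \<noteq> 0"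
proof
  assume s: "0 < s" and 0: "lik_mass (carrier_vec p) s = 0"
  have [measurable]: "carrier_vec p \<in> sets (borel_vec p)" using sets.top[of "borel_vec p"] by simp
  have "AE \<beta> in prior_m. ennreal (exp (- sq_dist \<beta> / (2 * s))) * indicator (carrier_vec p) \<beta> = 0"
    using 0 unfolding lik_mass_def by (subst (asm) nn_integral_0_iff_AE) measurable
  moreover have "AE \<beta> in prior_m. \<beta> \<in> carrier_vec p" by (rule AE_I2) simp
  ultimately have "AE \<beta> in prior_m. False"
    by eventually_elim simp
  then show False by simp
qed

lemma lik_mass_measurable [measurable]:
  assumes [measurable]: "A \<in> sets (borel_vec p)"
  shows "lik_mass A \<in> borel_measurable borel"
  unfolding lik_mass_def[abs_def] by measurable

text \<open>
  The quasi-likelihood is positive for every positive variance, and the variance prior charges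
  only those.
\<close>

lemma evidence_pos: "E \<noteq> 0"
proof
  assume 0: "E = 0"
  have [measurable]: "carrier_vec p \<in> sets (borel_vec p)" using sets.top[of "borel_vec p"] by simp
  have "AE s in S y. ennreal (lik_factor s) * lik_mass (carrier_vec p) s = 0"
    using 0 unfolding evidence_eq by (subst (asm) nn_integral_0_iff_AE) measurable
  moreover have "AE s in S y. s \<in> {0<..}"
    using vprior y by (intro var.AE_in_set_eq_1[THEN iffD2]) (auto simp: variance_prior_def)
  ultimately have "AE s in S y. False"
  proof eventually_elim
    case (elim s)
    then have "0 < lik_factor s" by (simp add: lik_factor_def)
    then show False using elim lik_mass_nonzero[of s] by auto
  qed
  then show False by simp
qed

lemma evidence_finite: "E \<noteq> \<infinity>"
  using proper by (auto simp: proper_posterior_def)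

lemma emeasure_quasi_posterior:
  assumes A: "A \<in> sets (borel_vec p)" and C: "C \<in> sets borel"
  shows "emeasure (quasi_posterior X \<pi> S y) (A \<times> C) =
    (\<integral>\<^sup>+s. ennreal (lik_factor s) * lik_mass A s * indicator C s \<partial>S y) / E"
proof -
  have [measurable]: "A \<in> sets prior_m" "C \<in> sets (S y)" using A C sets_prior sets_S by auto
  note m = lik_measurable[unfolded case_prod_beta', measurable]
  have "emeasure (quasi_posterior X \<pi> S y) (A \<times> C) =
    (\<integral>\<^sup>+z. ennreal (quasi_lik X y (fst z) (snd z)) / E * indicator (A \<times> C) z \<partial>(prior_m \<Otimes>\<^sub>M S y))"
    unfolding quasi_posterior_def joint_prior_def dims_X case_prod_beta'
    by (rule emeasure_density) measurable
  also have "\<dots> = (\<integral>\<^sup>+z. ennreal (quasi_lik X y (fst z) (snd z)) * indicator (A \<times> C) z / E \<partial>(prior_m \<Otimes>\<^sub>M S y))"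
    by (simp add: divide_ennreal_def mult_ac)
  also have "\<dots> = (\<integral>\<^sup>+z. ennreal (quasi_lik X y (fst z) (snd z)) * indicator (A \<times> C) z \<partial>(prior_m \<Otimes>\<^sub>M S y)) / E"
    by (rule nn_integral_divide) measurable
  finally show ?thesis by (simp add: lik_rectangle[OF A C])
qed

lemma sets_quasi_posterior [measurable_cong]:
  "sets (quasi_posterior X \<pi> S y) = sets (borel_vec p \<Otimes>\<^sub>M borel)"
  unfolding quasi_posterior_def joint_prior_def
  by (simp, intro sets_pair_measure_cong sets_prior sets_S)

lemma space_quasi_posterior: "space (quasi_posterior X \<pi> S y) = carrier_vec p \<times> UNIV"
  using sets_eq_imp_space_eq[OF sets_quasi_posterior] by (simp add: space_pair_measure)

lemma emeasure_beta_posterior: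
  assumes A: "A \<in> sets (borel_vec p)"
  shows "emeasure (beta_posterior X \<pi> S y) A = emeasure (quasi_posterior X \<pi> S y) (A \<times> UNIV)"
proof -
  have "fst -` A \<inter> space (quasi_posterior X \<pi> S y) = A \<times> UNIV"
    using sets.sets_into_space[OF A] by (auto simp: space_quasi_posterior)
  then show ?thesis
    unfolding beta_posterior_def dims_X using A by (subst emeasure_distr) auto
qed

lemma emeasure_variance_posterior:
  assumes C: "C \<in> sets borel"
  shows "emeasure (variance_posterior X \<pi> S y) C = emeasure (quasi_posterior X \<pi> S y) (carrier_vec p \<times> C)"
proof -
  have "snd -` C \<inter> space (quasi_posterior X \<pi> S y) = carrier_vec p \<times> C"
    by (auto simp: space_quasi_posterior)
  then show ?thesis
    unfolding variance_posterior_def using C by (subst emeasure_distr) auto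
qed

lemma carrier_vec_sets [measurable]: "carrier_vec p \<in> sets (borel_vec p)"
  using sets.top[of "borel_vec p"] by simp

lemma emeasure_quasi_posterior_space: "emeasure (quasi_posterior X \<pi> S y) (carrier_vec p \<times> UNIV) = 1"
proof -
  have "emeasure (quasi_posterior X \<pi> S y) (carrier_vec p \<times> UNIV) = E / E"
    by (subst emeasure_quasi_posterior) (simp_all add: evidence_eq)
  then show ?thesis using evidence_pos evidence_finite by (simp add: top.not_eq_extremum)
qed

lemma sets_beta_posterior: "sets (beta_posterior X \<pi> S y) = sets (borel_vec p)"
  by (simp add: beta_posterior_def)

sublocale beta_post: prob_space "beta_posterior X \<pi> S y"
proof
  have "space (beta_posterior X \<pi> S y) = carrier_vec p" by (simp add: beta_posterior_def)
  then show "emeasure (beta_posterior X \<pi> S y) (space (beta_posterior X \<pi> S y)) = 1"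
    by (simp add: emeasure_beta_posterior emeasure_quasi_posterior_space)
qed

sublocale var_post: prob_space "variance_posterior X \<pi> S y"
proof
  have "space (variance_posterior X \<pi> S y) = UNIV" by (simp add: variance_posterior_def)
  then show "emeasure (variance_posterior X \<pi> S y) (space (variance_posterior X \<pi> S y)) = 1"
    by (simp add: emeasure_variance_posterior emeasure_quasi_posterior_space)
qed

text \<open>
  A comparison of the conditional laws, uniform over variances in \<open>C\<close>, passes to the mixture.
  Because it is phrased through unnormalised masses, the conditional laws need not be constructed.
\<close>

lemma beta_posterior_lower_bound:
  assumes A: "A \<in> sets (borel_vec p)" and C: "C \<in> sets borel" and k: "0 \<le> k"
    and le: "\<And>s. s \<in> C \<Longrightarrow> ennreal k * lik_mass (carrier_vec p) s \<le> lik_mass A s"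
  shows "k * measure (variance_posterior X \<pi> S y) C \<le> measure (beta_posterior X \<pi> S y) A"
proof -
  note [measurable] = A C
  have "ennreal k * emeasure (variance_posterior X \<pi> S y) C =
      (\<integral>\<^sup>+s. ennreal k * (ennreal (lik_factor s) * lik_mass (carrier_vec p) s * indicator C s) \<partial>S y) / E"
    unfolding emeasure_variance_posterior[OF C] emeasure_quasi_posterior[OF carrier_vec_sets C]
    by (subst nn_integral_cmult) (auto simp: divide_ennreal_def mult_ac)
  also have "\<dots> \<le> (\<integral>\<^sup>+s. ennreal (lik_factor s) * lik_mass A s * indicator UNIV s \<partial>S y) / E"
  proof (intro divide_right_mono_ennreal nn_integral_mono)
    fix s
    show "ennreal k * (ennreal (lik_factor s) * lik_mass (carrier_vec p) s * indicator C s) \<le>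
      ennreal (lik_factor s) * lik_mass A s * indicator UNIV s"
    proof (cases "s \<in> C")
      case True
      have "ennreal k * (ennreal (lik_factor s) * lik_mass (carrier_vec p) s * indicator C s) =
        ennreal (lik_factor s) * (ennreal k * lik_mass (carrier_vec p) s)"
        using True by (simp add: mult_ac)
      also have "\<dots> \<le> ennreal (lik_factor s) * lik_mass A s" by (intro mult_left_mono le True) simp
      finally show ?thesis by simp
    qed simp
  qed
  also have "\<dots> = emeasure (beta_posterior X \<pi> S y) A"
    unfolding emeasure_beta_posterior[OF A] by (subst emeasure_quasi_posterior[OF A]) auto
  finally show ?thesis
    using k by (simp add: var_post.emeasure_eq_measure beta_post.emeasure_eq_measure
        ennreal_mult[symmetric])
qed

section \<open>Comparison with the limiting normal law\<close>

definition normal_dens :: "real \<Rightarrow> rvec \<Rightarrow> real" where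
  "normal_dens v \<beta> = exp (- sq_dist \<beta> / (2 * v)) / gauss_int v"

abbreviation "limit_normal \<sigma> \<equiv> normal_vec bhat (smult_mat (\<sigma>\<^sup>2) (mat_inv (gram X)))"

lemma limit_normal_eq: "0 < \<sigma> \<Longrightarrow> limit_normal \<sigma> = density (lborel_vec p) (\<lambda>\<beta>. ennreal (normal_dens (\<sigma>\<^sup>2) \<beta>))"
  unfolding normal_dens_def sq_dist_def gauss_int_def by (rule normal_vec_eq_density[OF X rk bhat_carrier])

lemma normal_dens_measurable [measurable]: "normal_dens v \<in> borel_measurable (borel_vec p)"
  unfolding normal_dens_def[abs_def] by measurable

lemma gaussian_integral: "0 < s \<Longrightarrow> (\<integral>\<^sup>+\<beta>. ennreal (exp (- sq_dist \<beta> / (2 * s))) \<partial>lborel_vec p) = ennreal (gauss_int s)"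
  unfolding sq_dist_def gauss_int_def by (rule gaussian_integral_vec(1)[OF X rk bhat_carrier])

lemma normal_dens_nonneg: "0 < v \<Longrightarrow> 0 \<le> normal_dens v \<beta>"
  using gauss_int_pos[of v] by (simp add: normal_dens_def)

lemma normal_dens_integral: "0 < v \<Longrightarrow> (\<integral>\<^sup>+\<beta>. ennreal (normal_dens v \<beta>) \<partial>lborel_vec p) = 1"
proof -
  assume v: "0 < v"
  have "(\<integral>\<^sup>+\<beta>. ennreal (normal_dens v \<beta>) \<partial>lborel_vec p) =
      (\<integral>\<^sup>+\<beta>. ennreal (1 / gauss_int v) * ennreal (exp (- sq_dist \<beta> / (2 * v))) \<partial>lborel_vec p)"
    using gauss_int_pos[OF v] by (intro nn_integral_cong) (simp add: normal_dens_def ennreal_mult[symmetric])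
  also have "\<dots> = ennreal (1 / gauss_int v) * ennreal (gauss_int v)"
    by (subst nn_integral_cmult) (auto simp: gaussian_integral[OF v, simplified])
  also have "\<dots> = 1" using gauss_int_pos[OF v] by (simp add: ennreal_mult[symmetric])
  finally show ?thesis .
qed

lemma sets_limit_normal: "0 < \<sigma> \<Longrightarrow> sets (limit_normal \<sigma>) = sets (borel_vec p)"
  by (simp add: limit_normal_eq sets_lborel_vec)

lemma space_limit_normal: "0 < \<sigma> \<Longrightarrow> space (limit_normal \<sigma>) = carrier_vec p"
  by (simp add: limit_normal_eq)

lemma emeasure_limit_normal:
  assumes "0 < \<sigma>" and [measurable]: "A \<in> sets (borel_vec p)"
  shows "emeasure (limit_normal \<sigma>) A = (\<integral>\<^sup>+\<beta>. ennreal (normal_dens (\<sigma>\<^sup>2) \<beta>) * indicator A \<beta> \<partial>lborel_vec p)"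
  unfolding limit_normal_eq[OF assms(1)] by (rule emeasure_density) measurable

lemma prob_space_limit_normal:
  assumes "0 < \<sigma>"
  shows "prob_space (limit_normal \<sigma>)"
proof
  have "emeasure (limit_normal \<sigma>) (space (limit_normal \<sigma>)) =
      (\<integral>\<^sup>+\<beta>. ennreal (normal_dens (\<sigma>\<^sup>2) \<beta>) * indicator (carrier_vec p) \<beta> \<partial>lborel_vec p)"
    using assms by (simp add: space_limit_normal emeasure_limit_normal)
  also have "\<dots> = (\<integral>\<^sup>+\<beta>. ennreal (normal_dens (\<sigma>\<^sup>2) \<beta>) \<partial>lborel_vec p)"
    by (intro nn_integral_cong) simp
  finally show "emeasure (limit_normal \<sigma>) (space (limit_normal \<sigma>)) = 1" using normal_dens_integral[of "\<sigma>\<^sup>2"] assms by simp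
qed

definition ellipsoid :: "real \<Rightarrow> rvec set" where
  "ellipsoid c = {\<beta> \<in> carrier_vec p. sq_dist \<beta> \<le> c}"

lemma ellipsoid_sets [measurable]: "ellipsoid c \<in> sets (borel_vec p)"
proof -
  have "{\<beta> \<in> space (borel_vec p). sq_dist \<beta> \<le> c} \<in> sets (borel_vec p)" by measurable
  then show ?thesis by (simp add: ellipsoid_def)
qed

lemma gauss_int_scale: "0 < s \<Longrightarrow> 0 < r \<Longrightarrow> gauss_int (r * s) = sqrt (r ^ p) * gauss_int s"
  by (simp add: gauss_int_def real_sqrt_mult[symmetric] power_mult_distrib mult_ac)

text \<open>
  Outside the ellipsoid half of the exponent is at least \<open>w / 4\<close>; the other half is the
  exponent of a Gaussian with doubled variance, whose integral is larger by the factor \<open>sqrt (2 ^ p)\<close>.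
\<close>

lemma limit_normal_tail:
  assumes \<sigma>: "0 < \<sigma>"
  shows "measure (limit_normal \<sigma>) (carrier_vec p - ellipsoid (w * \<sigma>\<^sup>2)) \<le> exp (- w / 4) * sqrt (2 ^ p)"
proof -
  interpret Q: prob_space "limit_normal \<sigma>" by (rule prob_space_limit_normal[OF \<sigma>])
  define v where "v = \<sigma>\<^sup>2"
  have v: "0 < v" using \<sigma> by (simp add: v_def)
  let ?T = "carrier_vec p - ellipsoid (w * v)"
  have Z2: "gauss_int (2 * v) = sqrt (2 ^ p) * gauss_int v" by (rule gauss_int_scale[OF v]) simp
  have T: "?T \<in> sets (borel_vec p)" by measurable
  have "emeasure (limit_normal \<sigma>) ?T \<le> (\<integral>\<^sup>+\<beta>. ennreal (exp (- w / 4) / gauss_int v) * ennreal (exp (- sq_dist \<beta> / (2 * (2 * v)))) \<partial>lborel_vec p)"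
    unfolding emeasure_limit_normal[OF \<sigma> T] unfolding v_def[symmetric]
  proof (rule nn_integral_mono)
    fix \<beta> assume "\<beta> \<in> space (lborel_vec p)"
    then have \<beta>: "\<beta> \<in> carrier_vec p" by simp
    show "ennreal (normal_dens v \<beta>) * indicator ?T \<beta> \<le>
      ennreal (exp (- w / 4) / gauss_int v) * ennreal (exp (- sq_dist \<beta> / (2 * (2 * v))))"
    proof (cases "\<beta> \<in> ?T")
      case True
      then have "w * v \<le> sq_dist \<beta>" by (auto simp: ellipsoid_def)
      then have "w \<le> sq_dist \<beta> / v" using v by (simp add: pos_le_divide_eq)
      moreover have "sq_dist \<beta> / (2 * v) = (sq_dist \<beta> / v) / 2" "sq_dist \<beta> / (2 * (2 * v)) = (sq_dist \<beta> / v) / 4"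
        by simp_all
      ultimately have "- sq_dist \<beta> / (2 * v) \<le> - w / 4 + (- sq_dist \<beta> / (2 * (2 * v)))"
        by (simp add: minus_divide_left[symmetric])
      then have "exp (- sq_dist \<beta> / (2 * v)) \<le> exp (- w / 4) * exp (- sq_dist \<beta> / (2 * (2 * v)))"
        by (simp only: exp_add[symmetric] exp_le_cancel_iff)
      then have "normal_dens v \<beta> \<le> exp (- w / 4) / gauss_int v * exp (- sq_dist \<beta> / (2 * (2 * v)))"
        using gauss_int_pos[OF v] by (simp add: normal_dens_def divide_right_mono)
      then show ?thesis
        using True gauss_int_pos[OF v] by (simp add: ennreal_mult[symmetric] ennreal_leI)
    qed simp
  qed
  also have "\<dots> = ennreal (exp (- w / 4) / gauss_int v) * ennreal (gauss_int (2 * v))"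
    by (subst nn_integral_cmult) (use gaussian_integral[of "2 * v", simplified] v in auto)
  also have "\<dots> = ennreal (exp (- w / 4) * sqrt (2 ^ p))"
    using gauss_int_pos[OF v] by (simp add: Z2 ennreal_mult[symmetric] del: real_sqrt_power)
  finally show ?thesis
    by (simp add: v_def Q.emeasure_eq_measure)
qed

text \<open>
  Inside \<open>B\<close> the prior density is at most \<open>\<pi> \<beta> / x\<close>, which leaves a Gaussian integral; outside, the
  exponential is at most its value on the boundary of the ellipsoid and the prior has mass at most \<open>1\<close>.
\<close>

lemma conditional_normaliser_bound:
  assumes s: "0 < s" and B: "B \<subseteq> carrier_vec p" "ellipsoid c \<subseteq> B" and \<beta>: "\<beta> \<in> B"
    and x: "0 \<le> x" and ratio: "\<And>\<beta>'. \<beta>' \<in> B \<Longrightarrow> x * \<pi> \<beta>' \<le> \<pi> \<beta>"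
  shows "x * enn2real (lik_mass (carrier_vec p) s) \<le> \<pi> \<beta> * gauss_int s + exp (- c / (2 * s)) * x"
proof -
  define \<tau> where "\<tau> = exp (- c / (2 * s))"
  have \<pi>\<beta>: "0 \<le> \<pi> \<beta>" using pi_nonneg \<beta> B by auto
  have J1: "lik_mass (carrier_vec p) s \<le> 1" by (rule lik_mass_le_1[OF s])
  then have lik_mass: "lik_mass (carrier_vec p) s = ennreal (enn2real (lik_mass (carrier_vec p) s))"
    by (intro ennreal_enn2real[symmetric]) (auto simp: less_top[symmetric] top_unique)
  have "ennreal x * lik_mass (carrier_vec p) s =
    (\<integral>\<^sup>+\<beta>'. ennreal x * (ennreal (\<pi> \<beta>') * (ennreal (exp (- sq_dist \<beta>' / (2 * s))) * indicator (carrier_vec p) \<beta>')) \<partial>lborel_vec p)"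
    unfolding lik_mass_lebesgue[OF carrier_vec_sets] by (rule nn_integral_cmult[symmetric]) measurable
  also have "\<dots> \<le> (\<integral>\<^sup>+\<beta>'. ennreal (\<pi> \<beta>) * ennreal (exp (- sq_dist \<beta>' / (2 * s))) + ennreal (\<tau> * x) * ennreal (\<pi> \<beta>') \<partial>lborel_vec p)"
  proof (rule nn_integral_mono)
    fix \<beta>' assume "\<beta>' \<in> space (lborel_vec p)"
    then have \<beta>': "\<beta>' \<in> carrier_vec p" by simp
    let ?e = "exp (- sq_dist \<beta>' / (2 * s))"
    have \<pi>': "0 \<le> \<pi> \<beta>'" by (rule pi_nonneg[OF \<beta>'])
    have "x * (\<pi> \<beta>' * ?e) \<le> \<pi> \<beta> * ?e + \<tau> * x * \<pi> \<beta>'"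
    proof (cases "\<beta>' \<in> B")
      case True
      have "x * \<pi> \<beta>' * ?e \<le> \<pi> \<beta> * ?e" by (rule mult_right_mono[OF ratio[OF True]]) simp
      moreover have "0 \<le> \<tau> * x * \<pi> \<beta>'" using x \<pi>' by (simp add: \<tau>_def)
      moreover have "x * (\<pi> \<beta>' * ?e) = x * \<pi> \<beta>' * ?e" by simp
      ultimately show ?thesis by linarith
    next
      case False
      then have "\<beta>' \<notin> ellipsoid c" using B by auto
      then have "c \<le> sq_dist \<beta>'" using \<beta>' by (auto simp: ellipsoid_def)
      then have "?e \<le> \<tau>" using s by (simp add: \<tau>_def divide_right_mono)
      then have "(x * \<pi> \<beta>') * ?e \<le> (x * \<pi> \<beta>') * \<tau>" by (rule mult_left_mono) (use x \<pi>' in simp)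
      moreover have "0 \<le> \<pi> \<beta> * ?e" using \<pi>\<beta> by simp
      ultimately show ?thesis by (simp add: mult_ac)
    qed
    then have "ennreal (x * (\<pi> \<beta>' * ?e)) \<le> ennreal (\<pi> \<beta> * ?e + \<tau> * x * \<pi> \<beta>')" by (rule ennreal_leI)
    then show "ennreal x * (ennreal (\<pi> \<beta>') * (ennreal ?e * indicator (carrier_vec p) \<beta>')) \<le>
      ennreal (\<pi> \<beta>) * ennreal ?e + ennreal (\<tau> * x) * ennreal (\<pi> \<beta>')"
      using x \<pi>' \<pi>\<beta> \<beta>' by (simp add: ennreal_mult ennreal_plus \<tau>_def)
  qed
  also have "\<dots> = ennreal (\<pi> \<beta>) * ennreal (gauss_int s) + ennreal (\<tau> * x) * 1"
  proof -
    have "(\<integral>\<^sup>+\<beta>'. ennreal (\<pi> \<beta>') \<partial>lborel_vec p) = 1"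
      using nn_integral_prior[of "\<lambda>_. 1"] prior.emeasure_space_1 by simp
    then show ?thesis
      by (subst nn_integral_add) (auto simp: nn_integral_cmult gaussian_integral[OF s, simplified])
  qed
  also have "\<dots> = ennreal (\<pi> \<beta> * gauss_int s + \<tau> * x)"
    using \<pi>\<beta> x gauss_int_pos[OF s] by (simp add: ennreal_mult ennreal_plus \<tau>_def)
  finally have "ennreal (x * enn2real (lik_mass (carrier_vec p) s)) \<le> ennreal (\<pi> \<beta> * gauss_int s + \<tau> * x)"
    using x by (subst (asm) lik_mass) (simp add: ennreal_mult)
  then show ?thesis
    using \<pi>\<beta> x gauss_int_pos[OF s] by (subst (asm) ennreal_le_iff) (auto simp: \<tau>_def)
qed

text \<open>
  The tail term in the preceding bound is controlled by the prior density at \<open>\<beta>0\<close>. Since it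
  carries the factor \<open>x\<close>, the estimate \<open>x \<pi>(\<beta>0) \<le> \<pi>(\<beta>)\<close> turns it into \<open>t \<pi>(\<beta>) Z\<close>, with no division by \<open>x\<close>.
  What remains is \<open>x D \<le> (1 + t) \<pi>(\<beta>) Z\<close> together with \<open>(1 + t) (x - t) \<le> x\<close>.
\<close>

lemma prior_dominates_normaliser:
  assumes s: "0 < s" and B: "B \<subseteq> carrier_vec p" "ellipsoid c \<subseteq> B" and \<beta>: "\<beta> \<in> B" and \<beta>0: "\<beta>0 \<in> B"
    and x: "0 \<le> x" "x \<le> 1" and ratio: "\<And>\<beta> \<beta>'. \<beta> \<in> B \<Longrightarrow> \<beta>' \<in> B \<Longrightarrow> x * \<pi> \<beta>' \<le> \<pi> \<beta>"
    and t: "0 \<le> t" "exp (- c / (2 * s)) \<le> t * (\<pi> \<beta>0 * gauss_int s)"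
  shows "(x - t) * enn2real (lik_mass (carrier_vec p) s) \<le> \<pi> \<beta> * gauss_int s"
proof -
  define D where "D = enn2real (lik_mass (carrier_vec p) s)"
  have D: "0 \<le> D" by (simp add: D_def)
  have "exp (- c / (2 * s)) * x \<le> t * (\<pi> \<beta>0 * gauss_int s) * x" by (rule mult_right_mono[OF t(2) x(1)])
  also have "\<dots> = t * ((x * \<pi> \<beta>0) * gauss_int s)" by simp
  also have "\<dots> \<le> t * (\<pi> \<beta> * gauss_int s)"
    by (intro mult_left_mono mult_right_mono ratio \<beta> \<beta>0) (use t gauss_int_pos[OF s] in auto)
  finally have "x * D \<le> (1 + t) * (\<pi> \<beta> * gauss_int s)"
    using conditional_normaliser_bound[OF s B \<beta> x(1) ratio[OF \<beta>]] by (simp add: D_def algebra_simps)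
  moreover have "(1 + t) * (x - t) \<le> x"
  proof -
    have "t * x \<le> t * 1" by (rule mult_left_mono[OF x(2) t(1)])
    moreover have "0 \<le> t * t" by simp
    moreover have "(1 + t) * (x - t) = x + t * x - t - t * t" by (simp add: algebra_simps)
    ultimately show ?thesis by linarith
  qed
  then have "(1 + t) * (x - t) * D \<le> x * D" by (rule mult_right_mono[OF _ D])
  ultimately have "(1 + t) * ((x - t) * D) \<le> (1 + t) * (\<pi> \<beta> * gauss_int s)" by (simp add: mult.assoc)
  then show ?thesis using t(1) by (simp add: D_def mult_le_cancel_left)
qed

text \<open>
  With \<open>r = s / v\<close>, the normalising constants differ by the factor \<open>sqrt (r ^ p) \<le> exp (\<delta> p / 2)\<close>.
  The exponents differ by at most \<open>\<delta> w\<close> on the ellipsoid, because \<open>1 / r - 1 \<le> 2 \<delta>\<close> for \<open>\<delta> \<le> 1 / 2\<close>.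
\<close>

lemma gaussian_variance_perturbation:
  assumes v: "0 < v" and \<delta>: "0 \<le> \<delta>" "\<delta> \<le> 1 / 2" and s: "\<bar>s / v - 1\<bar> \<le> \<delta>"
    and w: "0 \<le> w" and sq: "sq_dist \<beta> \<le> w * v"
  shows "(1 - \<delta> * (real p / 2 + w)) * normal_dens v \<beta> \<le> normal_dens s \<beta>"
proof -
  define r where "r = s / v"
  have r: "1 - \<delta> \<le> r" "r \<le> 1 + \<delta>" using s by (auto simp: r_def abs_le_iff)
  then have r0: "0 < r" using \<delta> by linarith
  have sv: "s = r * v" using v by (simp add: r_def)
  have Zs: "gauss_int s = sqrt (r ^ p) * gauss_int v" unfolding sv by (rule gauss_int_scale[OF v r0])
  have "r ^ p \<le> exp (\<delta> * real p)"
  proof -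
    have "r \<le> exp \<delta>" using r(2) exp_ge_add_one_self[of \<delta>] by linarith
    then have "r ^ p \<le> exp \<delta> ^ p" using r0 by (intro power_mono) auto
    then show ?thesis by (simp add: exp_of_nat_mult[symmetric] mult.commute)
  qed
  then have "sqrt (r ^ p) \<le> sqrt (exp (\<delta> * real p))" by (rule real_sqrt_le_mono)
  also have "sqrt (exp (\<delta> * real p)) = exp (\<delta> * real p / 2)"
    by (rule real_sqrt_unique) (simp_all add: power2_eq_square exp_add[symmetric])
  finally have Zr: "sqrt (r ^ p) \<le> exp (\<delta> * real p / 2)" .
  have "sq_dist \<beta> / (2 * s) - sq_dist \<beta> / (2 * v) \<le> \<delta> * w"
  proof -
    define d where "d = sq_dist \<beta> / v"
    have d: "0 \<le> d" "d \<le> w" using sq v sq_dist_nonneg[of \<beta>] by (auto simp: d_def pos_divide_le_eq)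
    have "1 / r \<le> 1 + 2 * \<delta>"
    proof -
      have "1 \<le> (1 + 2 * \<delta>) * (1 - \<delta>)"
        using mult_left_mono[OF \<delta>(2) \<delta>(1)] by (simp add: algebra_simps)
      also have "\<dots> \<le> (1 + 2 * \<delta>) * r" using r \<delta> by (intro mult_left_mono) auto
      finally show ?thesis using r0 by (simp add: pos_divide_le_eq)
    qed
    then have "d / 2 * (1 / r - 1) \<le> d / 2 * (2 * \<delta>)" using d by (intro mult_left_mono) auto
    also have "\<dots> \<le> w * \<delta>" using d \<delta> by (simp add: mult_right_mono)
    finally have "d / 2 * (1 / r - 1) \<le> \<delta> * w" by (simp add: mult.commute)
    moreover have "sq_dist \<beta> / (2 * s) - sq_dist \<beta> / (2 * v) = d / 2 * (1 / r - 1)"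
      using v r0 by (simp add: sv d_def field_simps)
    ultimately show ?thesis by simp
  qed
  then have "exp (- sq_dist \<beta> / (2 * v) - \<delta> * w) \<le> exp (- sq_dist \<beta> / (2 * s))" by simp
  then have ex: "exp (- sq_dist \<beta> / (2 * v)) * exp (- (\<delta> * w)) \<le> exp (- sq_dist \<beta> / (2 * s))"
    by (simp add: exp_add[symmetric])
  have "1 - \<delta> * (real p / 2 + w) \<le> exp (- (\<delta> * w)) / exp (\<delta> * real p / 2)"
    using exp_ge_add_one_self[of "- \<delta> * (real p / 2 + w)"]
    by (simp add: exp_diff[symmetric] algebra_simps)
  then have "(1 - \<delta> * (real p / 2 + w)) * normal_dens v \<beta> \<le> exp (- (\<delta> * w)) / exp (\<delta> * real p / 2) * normal_dens v \<beta>"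
    by (rule mult_right_mono[OF _ normal_dens_nonneg[OF v]])
  also have "\<dots> = (exp (- sq_dist \<beta> / (2 * v)) * exp (- (\<delta> * w))) / (exp (\<delta> * real p / 2) * gauss_int v)"
    by (simp add: normal_dens_def)
  also have "\<dots> \<le> exp (- sq_dist \<beta> / (2 * s)) / (sqrt (r ^ p) * gauss_int v)"
    by (rule frac_le) (use ex Zr gauss_int_pos[OF v] r0 in \<open>auto intro!: mult_right_mono mult_pos_pos\<close>)
  also have "\<dots> = normal_dens s \<beta>" by (simp add: normal_dens_def Zs)
  finally show ?thesis .
qed

text \<open>
  The product of the two pointwise bounds compares the unnormalised conditional density with
  \<open>D\<close> times the limiting normal density, for every good variance; mixing over the variance costs
  the factor \<open>1 - \<epsilon>\<close>.
\<close>

lemma posterior_dominates_normal: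
  assumes \<sigma>: "0 < \<sigma>" and \<delta>: "0 \<le> \<delta>" "\<delta> \<le> 1 / 2" and w: "0 \<le> w"
    and B: "B \<subseteq> carrier_vec p" "ellipsoid (w * \<sigma>\<^sup>2) \<subseteq> B" and \<beta>0: "\<beta>0 \<in> B"
    and x: "0 \<le> x" "x \<le> 1" and ratio: "\<And>\<beta> \<beta>'. \<beta> \<in> B \<Longrightarrow> \<beta>' \<in> B \<Longrightarrow> x * \<pi> \<beta>' \<le> \<pi> \<beta>"
    and t: "0 \<le> t" "t \<le> x"
      "\<And>s. \<bar>s / \<sigma>\<^sup>2 - 1\<bar> \<le> \<delta> \<Longrightarrow> exp (- (w * \<sigma>\<^sup>2) / (2 * s)) \<le> t * (\<pi> \<beta>0 * gauss_int s)"
    and \<eta>: "\<delta> * (real p / 2 + w) \<le> 1"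
    and \<epsilon>: "measure (variance_posterior X \<pi> S y) {s. \<bar>s / \<sigma>\<^sup>2 - 1\<bar> > \<delta>} \<le> \<epsilon>"
    and A: "A \<in> sets (borel_vec p)" "A \<subseteq> ellipsoid (w * \<sigma>\<^sup>2)"
  shows "(x - t) * (1 - \<delta> * (real p / 2 + w)) * (1 - \<epsilon>) * measure (limit_normal \<sigma>) A \<le>
    measure (beta_posterior X \<pi> S y) A"
proof -
  interpret Q: prob_space "limit_normal \<sigma>" by (rule prob_space_limit_normal[OF \<sigma>])
  define v where "v = \<sigma>\<^sup>2"
  have v: "0 < v" using \<sigma> by (simp add: v_def)
  define \<kappa> where "\<kappa> = (x - t) * (1 - \<delta> * (real p / 2 + w))"
  have \<kappa>: "0 \<le> \<kappa>" using t \<eta> by (simp add: \<kappa>_def)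
  define C where "C = {s. \<bar>s / v - 1\<bar> \<le> \<delta>}"
  have C: "C \<in> sets borel" unfolding C_def by measurable
  note [measurable] = A(1)
  have lik_mass: "ennreal (\<kappa> * measure (limit_normal \<sigma>) A) * lik_mass (carrier_vec p) s \<le> lik_mass A s" if s: "s \<in> C" for s
  proof -
    have sv: "\<bar>s / v - 1\<bar> \<le> \<delta>" using s by (simp add: C_def)
    have "0 < s"
    proof -
      have "0 < s / v" using sv \<delta> by (auto simp: abs_le_iff)
      then show ?thesis using v by (simp add: zero_less_divide_iff)
    qed
    note s0 = this
    define D where "D = enn2real (lik_mass (carrier_vec p) s)"
    have D: "0 \<le> D" by (simp add: D_def)
    have "lik_mass (carrier_vec p) s \<le> 1" by (rule lik_mass_le_1[OF s0])
    then have JD: "lik_mass (carrier_vec p) s = ennreal D"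
      unfolding D_def by (intro ennreal_enn2real[symmetric]) (auto simp: less_top[symmetric] top_unique)
    have point: "\<kappa> * D * normal_dens v \<beta> \<le> \<pi> \<beta> * exp (- sq_dist \<beta> / (2 * s))" if \<beta>: "\<beta> \<in> A" for \<beta>
    proof -
      have \<beta>E: "\<beta> \<in> ellipsoid (w * v)" using \<beta> A by (auto simp: v_def)
      then have \<beta>B: "\<beta> \<in> B" using B by (auto simp: v_def)
      have "(x - t) * D \<le> \<pi> \<beta> * gauss_int s"
        unfolding D_def
        by (rule prior_dominates_normaliser[OF s0 B \<beta>B \<beta>0 x ratio t(1)])
          (use t(3)[of s] sv in \<open>auto simp: v_def\<close>)
      moreover have "(1 - \<delta> * (real p / 2 + w)) * normal_dens v \<beta> \<le> normal_dens s \<beta>"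
        by (rule gaussian_variance_perturbation[OF v \<delta> sv w]) (use \<beta>E in \<open>simp add: ellipsoid_def\<close>)
      ultimately have "((x - t) * D) * ((1 - \<delta> * (real p / 2 + w)) * normal_dens v \<beta>) \<le> (\<pi> \<beta> * gauss_int s) * normal_dens s \<beta>"
        by (rule mult_mono) (use pi_nonneg[of \<beta>] \<beta>B B gauss_int_pos[OF s0] normal_dens_nonneg[OF v] \<eta> in auto)
      moreover have "gauss_int s * normal_dens s \<beta> = exp (- sq_dist \<beta> / (2 * s))" using gauss_int_pos[OF s0] by (simp add: normal_dens_def)
      ultimately show ?thesis by (simp add: \<kappa>_def mult_ac)
    qed
    have "ennreal (\<kappa> * measure (limit_normal \<sigma>) A) * lik_mass (carrier_vec p) s = ennreal (\<kappa> * D) * emeasure (limit_normal \<sigma>) A"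
      using \<kappa> D by (simp add: JD Q.emeasure_eq_measure ennreal_mult[symmetric] mult_ac)
    also have "\<dots> = (\<integral>\<^sup>+\<beta>. ennreal (\<kappa> * D) * (ennreal (normal_dens v \<beta>) * indicator A \<beta>) \<partial>lborel_vec p)"
      unfolding emeasure_limit_normal[OF \<sigma> A(1)] unfolding v_def[symmetric]
      by (rule nn_integral_cmult[symmetric]) measurable
    also have "\<dots> \<le> (\<integral>\<^sup>+\<beta>. ennreal (\<pi> \<beta>) * (ennreal (exp (- sq_dist \<beta> / (2 * s))) * indicator A \<beta>) \<partial>lborel_vec p)"
    proof (rule nn_integral_mono)
      fix \<beta> assume "\<beta> \<in> space (lborel_vec p)"
      then have \<pi>: "0 \<le> \<pi> \<beta>" by (simp add: pi_nonneg)
      show "ennreal (\<kappa> * D) * (ennreal (normal_dens v \<beta>) * indicator A \<beta>) \<le>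
        ennreal (\<pi> \<beta>) * (ennreal (exp (- sq_dist \<beta> / (2 * s))) * indicator A \<beta>)"
      proof (cases "\<beta> \<in> A")
        case True
        then have "ennreal (\<kappa> * D * normal_dens v \<beta>) \<le> ennreal (\<pi> \<beta> * exp (- sq_dist \<beta> / (2 * s)))"
          by (intro ennreal_leI point)
        then show ?thesis
          using True \<kappa> D \<pi> normal_dens_nonneg[OF v, of \<beta>] by (simp add: ennreal_mult)
      qed simp
    qed
    also have "\<dots> = lik_mass A s" by (rule lik_mass_lebesgue[OF A(1), symmetric])
    finally show ?thesis .
  qed
  have "measure (variance_posterior X \<pi> S y) C = 1 - measure (variance_posterior X \<pi> S y) {s. \<bar>s / v - 1\<bar> > \<delta>}"
  proof -
    have "C \<in> var_post.events" using C by (simp add: variance_posterior_def)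
    then have "measure (variance_posterior X \<pi> S y) (space (variance_posterior X \<pi> S y) - C) =
        1 - measure (variance_posterior X \<pi> S y) C" by (rule var_post.prob_compl)
    moreover have "space (variance_posterior X \<pi> S y) - C = {s. \<bar>s / v - 1\<bar> > \<delta>}"
      by (auto simp: variance_posterior_def C_def)
    ultimately show ?thesis by simp
  qed
  then have "1 - \<epsilon> \<le> measure (variance_posterior X \<pi> S y) C" using \<epsilon> by (simp add: v_def)
  then have "\<kappa> * measure (limit_normal \<sigma>) A * (1 - \<epsilon>) \<le> \<kappa> * measure (limit_normal \<sigma>) A * measure (variance_posterior X \<pi> S y) C"
    by (rule mult_left_mono) (use \<kappa> in simp)
  also have "\<dots> \<le> measure (beta_posterior X \<pi> S y) A"
    by (rule beta_posterior_lower_bound[OF A(1) C _ lik_mass]) (use \<kappa> in auto)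
  finally show ?thesis by (simp add: \<kappa>_def mult_ac)
qed

text \<open>
  If \<open>x < t\<close> or \<open>\<delta> (p / 2 + w) > 1\<close> the minorisation is not available, but then the right-hand
  side already exceeds \<open>1\<close>.
\<close>

lemma tv_dist_posterior_normal:
  assumes \<sigma>: "0 < \<sigma>" and \<delta>: "0 \<le> \<delta>" "\<delta> \<le> 1 / 2" and w: "0 \<le> w"
    and B: "B \<subseteq> carrier_vec p" "ellipsoid (w * \<sigma>\<^sup>2) \<subseteq> B" and \<beta>0: "\<beta>0 \<in> B"
    and x: "0 \<le> x" "x \<le> 1" and ratio: "\<And>\<beta> \<beta>'. \<beta> \<in> B \<Longrightarrow> \<beta>' \<in> B \<Longrightarrow> x * \<pi> \<beta>' \<le> \<pi> \<beta>"
    and t: "0 \<le> t"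
      "\<And>s. \<bar>s / \<sigma>\<^sup>2 - 1\<bar> \<le> \<delta> \<Longrightarrow> exp (- (w * \<sigma>\<^sup>2) / (2 * s)) \<le> t * (\<pi> \<beta>0 * gauss_int s)"
    and \<epsilon>: "0 \<le> \<epsilon>" "\<epsilon> \<le> 1" "measure (variance_posterior X \<pi> S y) {s. \<bar>s / \<sigma>\<^sup>2 - 1\<bar> > \<delta>} \<le> \<epsilon>"
  shows "tv_dist (beta_posterior X \<pi> S y) (limit_normal \<sigma>) \<le>
    (1 - x) + t + \<delta> * (real p / 2 + w) + \<epsilon> + exp (- w / 4) * sqrt (2 ^ p)"
proof -
  define \<eta> where "\<eta> = \<delta> * (real p / 2 + w)"
  have \<eta>0: "0 \<le> \<eta>" using \<delta> w by (simp add: \<eta>_def)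
  have tail0: "0 \<le> exp (- w / 4) * sqrt (2 ^ p)" by simp
  note probs = beta_post.prob_space_axioms prob_space_limit_normal[OF \<sigma>]
  show ?thesis
  proof (cases "t \<le> x \<and> \<eta> \<le> 1")
    case False
    then show ?thesis
      using tv_dist_le_1[OF probs] x t \<eta>0 \<epsilon> tail0 unfolding \<eta>_def[symmetric] by linarith
  next
    case True
    define \<kappa> where "\<kappa> = (x - t) * (1 - \<eta>) * (1 - \<epsilon>)"
    have k1: "(x - t) * (1 - \<eta>) \<le> 1"
      by (rule mult_le_one) (use True x t \<eta>0 in auto)
    have "x - t - \<eta> \<le> (x - t) * (1 - \<eta>)"
      using mult_right_mono[of "x - t" 1 \<eta>] x t \<eta>0 by (simp add: algebra_simps)
    moreover have "(x - t) * (1 - \<eta>) - \<epsilon> \<le> \<kappa>"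
      using mult_right_mono[OF k1 \<epsilon>(1)] by (simp add: \<kappa>_def algebra_simps)
    ultimately have \<kappa>_ge: "x - t - \<eta> - \<epsilon> \<le> \<kappa>" by linarith
    have "\<kappa> \<le> 1"
      unfolding \<kappa>_def by (rule mult_le_one) (use k1 \<epsilon> in auto)
    then have "tv_dist (beta_posterior X \<pi> S y) (limit_normal \<sigma>) \<le>
        1 - \<kappa> + measure (limit_normal \<sigma>) (space (limit_normal \<sigma>) - ellipsoid (w * \<sigma>\<^sup>2))"
    proof (rule tv_dist_le_of_minorization[OF probs, rotated 2])
      show "sets (beta_posterior X \<pi> S y) = sets (limit_normal \<sigma>)"
        by (simp add: sets_beta_posterior sets_limit_normal[OF \<sigma>])
      show "ellipsoid (w * \<sigma>\<^sup>2) \<in> beta_post.events" by (simp add: sets_beta_posterior)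
      fix A assume "A \<in> beta_post.events" "A \<subseteq> ellipsoid (w * \<sigma>\<^sup>2)"
      then show "\<kappa> * measure (limit_normal \<sigma>) A \<le> measure (beta_posterior X \<pi> S y) A"
        unfolding \<kappa>_def \<eta>_def
        by (intro posterior_dominates_normal[OF \<sigma> \<delta> w B \<beta>0 x ratio t(1) _ t(2) _ \<epsilon>(3)])
          (use True in \<open>auto simp: sets_beta_posterior \<eta>_def\<close>)
    qed
    also have "\<dots> \<le> 1 - \<kappa> + exp (- w / 4) * sqrt (2 ^ p)"
      using limit_normal_tail[OF \<sigma>, of w] by (simp add: space_limit_normal[OF \<sigma>])
    finally show ?thesis using \<kappa>_ge unfolding \<eta>_def[symmetric] by linarith
  qed
qed

text \<open>
  The assumed lower bound on the prior density is calibrated so that the volume factor of the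
  design cancels: \<open>sqrt (det (gram X)) / \<sigma> ^ p\<close> times the Gaussian integral is
  \<open>(2 pi s / \<sigma>\<^sup>2) ^ (p / 2)\<close>, which is at least \<open>1\<close>.
\<close>

lemma prior_times_gauss_int_lower_bound:
  assumes \<sigma>: "0 < \<sigma>" and g: "0 \<le> g" and s: "\<sigma>\<^sup>2 / 2 \<le> s"
    and \<pi>: "sqrt (Determinant.det (gram X)) / \<sigma> ^ p * g \<le> \<pi> \<beta>0"
  shows "g \<le> \<pi> \<beta>0 * gauss_int s"
proof -
  have v: "0 < \<sigma>\<^sup>2" using \<sigma> by simp
  have s0: "0 < s" using s v by linarith
  have "\<sigma>\<^sup>2 \<le> 2 * pi * s"
  proof -
    have "\<sigma>\<^sup>2 \<le> 2 * s" using s by simp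
    also have "\<dots> \<le> pi * (2 * s)" using pi_ge_two s0 by (simp add: mult_le_cancel_right1)
    finally show ?thesis by (simp add: mult_ac)
  qed
  then have "(\<sigma>\<^sup>2) ^ p \<le> (2 * pi * s) ^ p" by (intro power_mono) auto
  then have "sqrt ((\<sigma>\<^sup>2) ^ p) \<le> sqrt ((2 * pi * s) ^ p)" by (rule real_sqrt_le_mono)
  moreover have "sqrt ((\<sigma>\<^sup>2) ^ p) = \<sigma> ^ p"
    using \<sigma> by (intro real_sqrt_unique) (auto simp: power_mult[symmetric] mult.commute)
  ultimately have "\<sigma> ^ p \<le> sqrt (Determinant.det (gram X)) * gauss_int s"
    using det_gram_pos by (simp add: gauss_int_def real_sqrt_divide del: real_sqrt_power)
  then have "g \<le> g / \<sigma> ^ p * (sqrt (Determinant.det (gram X)) * gauss_int s)"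
    using g \<sigma> by (simp add: pos_le_divide_eq mult_left_mono)
  also have "\<dots> = (sqrt (Determinant.det (gram X)) / \<sigma> ^ p * g) * gauss_int s" by simp
  also have "\<dots> \<le> \<pi> \<beta>0 * gauss_int s" by (rule mult_right_mono[OF \<pi>]) (use gauss_int_pos[OF s0] in simp)
  finally show ?thesis .
qed

lemma ellipsoid_subset_Bset:
  assumes \<beta>0: "\<beta>0 \<in> carrier_vec p" and \<sigma>: "0 < \<sigma>" and w: "0 \<le> w"
    and near: "vnorm (mult_mat_vec X (bhat - \<beta>0)) \<le> a * \<sigma>" and R: "sqrt w + a \<le> R"
  shows "ellipsoid (w * \<sigma>\<^sup>2) \<subseteq> Bset X \<beta>0 \<sigma> R"
proof
  fix \<beta> assume "\<beta> \<in> ellipsoid (w * \<sigma>\<^sup>2)"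
  then have \<beta>: "\<beta> \<in> carrier_vec p" and le: "(vnorm (mult_mat_vec X (\<beta> - bhat)))\<^sup>2 \<le> w * \<sigma>\<^sup>2"
    by (auto simp: ellipsoid_def sq_dist_def)
  have "vnorm (mult_mat_vec X (\<beta> - bhat)) \<le> sqrt (w * \<sigma>\<^sup>2)" using le by (rule real_le_rsqrt)
  then have far: "vnorm (mult_mat_vec X (\<beta> - bhat)) \<le> sqrt w * \<sigma>"
    using \<sigma> by (simp add: real_sqrt_mult)
  have "\<beta> - \<beta>0 = (\<beta> - bhat) + (bhat - \<beta>0)"
    using \<beta> \<beta>0 bhat_carrier by (intro eq_vecI) auto
  then have "mult_mat_vec X (\<beta> - \<beta>0) = mult_mat_vec X (\<beta> - bhat) + mult_mat_vec X (bhat - \<beta>0)"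
    using mult_add_distrib_mat_vec[OF X, of "\<beta> - bhat" "bhat - \<beta>0"] \<beta> \<beta>0 bhat_carrier by simp
  then have "vnorm (mult_mat_vec X (\<beta> - \<beta>0)) \<le> sqrt w * \<sigma> + a * \<sigma>"
    using vnorm_triangle[of "mult_mat_vec X (\<beta> - bhat)" n "mult_mat_vec X (bhat - \<beta>0)"] far near X \<beta> \<beta>0 bhat_carrier
    by simp
  also have "\<dots> = (sqrt w + a) * \<sigma>" by (simp add: algebra_simps)
  also have "\<dots> \<le> R * \<sigma>" using R \<sigma> by (intro mult_right_mono) auto
  finally show "\<beta> \<in> Bset X \<beta>0 \<sigma> R" using \<beta> by (simp add: Bset_def)
qed

text \<open>
  The choice \<open>w = (4 C1 + 8) p ln n\<close> is dictated by \<open>exp (- w / 4)\<close>: it must absorb the prior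
  factor \<open>n powr (- C1 p)\<close> and the \<open>sqrt (2 ^ p) \<le> n ^ p\<close> of the Gaussian tail, and still leave \<open>n powr (- p)\<close>.
  The constant \<open>4 C1 + 9\<close> is at least \<open>w / (p ln n) + 1\<close>, as the variance error requires, and
  \<open>sqrt w \<le> (3 / 4) (4 C1 + 9) sqrt (p ln n)\<close>, which keeps the ellipsoid in the localisation set even
  if its centre is at the largest allowed distance from \<open>\<beta>0\<close>.
\<close>

lemma tv_dist_posterior_normal_log:
  assumes n: "2 \<le> n" and C1: "0 < C1" and \<beta>0: "\<beta>0 \<in> carrier_vec p" and \<sigma>: "0 < \<sigma>"
    and \<delta>1: "0 \<le> \<delta>1" "\<delta>1 < 1" and \<delta>2: "0 \<le> \<delta>2" "\<delta>2 < 1"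
    and \<pi>0: "sqrt (Determinant.det (gram X)) / \<sigma> ^ p * real n powr (- (C1 * real p)) \<le> \<pi> \<beta>0"
    and H: "y \<in> Hset X \<beta>0 \<sigma> \<pi> S \<delta>1 \<delta>2 (4 * C1 + 9)"
  shows "tv_dist (beta_posterior X \<pi> S y) (limit_normal \<sigma>) \<le>
    phi X \<beta>0 \<sigma> \<pi> ((4 * C1 + 9) * sqrt (real p * ln (real n))) +
    (4 * C1 + 9) * (\<delta>1 * real p * ln (real n) + \<delta>2 + real n powr (- (1 * real p)))"
proof -
  define L where "L = real p * ln (real n)"
  define c where "c = 4 * C1 + 9"
  define w where "w = (4 * C1 + 8) * L"
  define \<phi> where "\<phi> = phi X \<beta>0 \<sigma> \<pi> (c * sqrt L)"
  define t where "t = exp (- L)"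
  have ln_n: "1 / 2 \<le> ln (real n)"
  proof -
    have "exp (1 / 2 :: real) \<le> 2"
    proof (rule power2_le_imp_le)
      have "(exp (1 / 2 :: real))\<^sup>2 = exp 1" by (simp add: power2_eq_square exp_add[symmetric])
      then show "(exp (1 / 2 :: real))\<^sup>2 \<le> 2\<^sup>2" using exp_le by simp
    qed simp
    then have "1 / 2 \<le> ln (2 :: real)" by (subst ln_ge_iff) auto
    also have "\<dots> \<le> ln (real n)" using n by simp
    finally show ?thesis .
  qed
  have pL: "real p / 2 \<le> L"
    using mult_left_mono[OF ln_n, of "real p"] by (simp add: L_def)
  then have L: "0 \<le> L" by (meson divide_nonneg_nonneg of_nat_0_le_iff order_trans zero_le_numeral)
  have npow: "real n powr (- (k * real p)) = exp (- (k * L))" for k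
    using n by (simp add: powr_def L_def mult_ac)
  have t: "0 < t" "real n powr (- (1 * real p)) = t" using npow[of 1] by (simp_all add: t_def)
  have c: "9 \<le> c" using C1 by (simp add: c_def)
  have w: "0 \<le> w" using C1 L by (simp add: w_def)
  have \<pi>0_pos: "0 < \<pi> \<beta>0"
  proof -
    have "0 < sqrt (Determinant.det (gram X)) / \<sigma> ^ p * real n powr (- (C1 * real p))"
      using det_gram_pos \<sigma> n by simp
    with \<pi>0 show ?thesis by linarith
  qed
  have R: "0 \<le> c * sqrt L" using c L by simp
  note \<phi>_range = phi_range[OF X prior \<beta>0 \<pi>0_pos R less_imp_le[OF \<sigma>], folded \<phi>_def]
  have var: "measure (variance_posterior X \<pi> S y) {s. \<bar>s / \<sigma>\<^sup>2 - 1\<bar> > \<delta>1} \<le> \<delta>2"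
    and near: "vnorm (mult_mat_vec X (bhat - \<beta>0)) \<le> (c * sqrt L / 4) * \<sigma>"
    using H by (auto simp: Hset_def bhat_def c_def L_def)
  have "tv_dist (beta_posterior X \<pi> S y) (limit_normal \<sigma>) \<le> \<phi> + c * (\<delta>1 * L + \<delta>2 + t)"
  proof (cases "\<delta>1 \<le> 1 / 2")
    case False
    have "1 \<le> \<delta>1 * L * c + t * c"
    proof (cases "p = 0")
      case True
      then show ?thesis using c by (simp add: L_def t_def)
    next
      case p: False
      then have "1 / 2 \<le> L" using pL by (simp add: divide_le_eq) 
      then have "1 / 2 * (1 / 2) \<le> \<delta>1 * L" using False by (intro mult_mono) auto
      then have "1 / 4 * 9 \<le> \<delta>1 * L * c" using c \<delta>1 L by (intro mult_mono) auto
      moreover have "0 \<le> t * c" using t c by simp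
      ultimately show ?thesis by linarith
    qed
    moreover have "0 \<le> c * \<delta>2" using c \<delta>2 by simp
    moreover have "c * (\<delta>1 * L + \<delta>2 + t) = \<delta>1 * L * c + t * c + c * \<delta>2" by (simp add: algebra_simps)
    ultimately show ?thesis
      using tv_dist_le_1[OF beta_post.prob_space_axioms prob_space_limit_normal[OF \<sigma>]] \<phi>_range(1) by linarith
  next
    case True
    let ?B = "Bset X \<beta>0 \<sigma> (c * sqrt L)"
    have ell: "ellipsoid (w * \<sigma>\<^sup>2) \<subseteq> ?B"
    proof (rule ellipsoid_subset_Bset[OF \<beta>0 \<sigma> w near])
      define a where "a = sqrt (4 * C1 + 8)"
      have "a\<^sup>2 = 4 * C1 + 8" using C1 by (simp add: a_def)
      moreover have "0 \<le> (a - 2 / 3)\<^sup>2" by simp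
      ultimately have "a \<le> 3 / 4 * c" by (simp add: c_def power2_eq_square algebra_simps)
      then have "a * sqrt L \<le> 3 / 4 * c * sqrt L" using L by (intro mult_right_mono) auto
      then show "sqrt w + c * sqrt L / 4 \<le> c * sqrt L"
        by (simp add: w_def a_def real_sqrt_mult)
    qed
    have "tv_dist (beta_posterior X \<pi> S y) (limit_normal \<sigma>) \<le>
      (1 - (1 - \<phi>)) + t + \<delta>1 * (real p / 2 + w) + \<delta>2 + exp (- w / 4) * sqrt (2 ^ p)"
    proof (rule tv_dist_posterior_normal[OF \<sigma> \<delta>1(1) True w _ ell])
      show "?B \<subseteq> carrier_vec p" by (auto simp: Bset_def)
      show "\<beta>0 \<in> ?B" by (rule center_in_Bset[OF X \<beta>0 R less_imp_le[OF \<sigma>]])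
      show "(1 - \<phi>) * \<pi> \<beta>' \<le> \<pi> \<beta>" if "\<beta> \<in> ?B" "\<beta>' \<in> ?B" for \<beta> \<beta>'
        unfolding \<phi>_def by (rule phi_ratio[OF X prior that(2,1)])
      fix s assume s: "\<bar>s / \<sigma>\<^sup>2 - 1\<bar> \<le> \<delta>1"
      have v: "0 < \<sigma>\<^sup>2" using \<sigma> by simp
      have "1 / 2 \<le> s / \<sigma>\<^sup>2" "s / \<sigma>\<^sup>2 \<le> 2" using s True by (auto simp: abs_le_iff)
      then have s2: "\<sigma>\<^sup>2 / 2 \<le> s" "s \<le> 2 * \<sigma>\<^sup>2"
        using v by (simp_all add: pos_le_divide_eq pos_divide_le_eq)
      have s0: "0 < s" using s2 v by linarith
      have "w / 4 \<le> (w * \<sigma>\<^sup>2) / (2 * s)"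
        using mult_left_mono[OF s2(2) w] s0 by (simp add: pos_le_divide_eq)
      then have "exp (- (w * \<sigma>\<^sup>2) / (2 * s)) \<le> exp (- (w / 4))" by simp
      also have "\<dots> \<le> t * real n powr (- (C1 * real p))"
        unfolding npow t_def exp_add[symmetric] exp_le_cancel_iff
        using L by (simp add: w_def algebra_simps)
      also have "\<dots> \<le> t * (\<pi> \<beta>0 * gauss_int s)"
        by (intro mult_left_mono prior_times_gauss_int_lower_bound[OF \<sigma> _ s2(1) \<pi>0]) (use t in auto)
      finally show "exp (- (w * \<sigma>\<^sup>2) / (2 * s)) \<le> t * (\<pi> \<beta>0 * gauss_int s)" .
    qed (use \<phi>_range t \<delta>2 var in auto)
    moreover have "exp (- w / 4) * sqrt (2 ^ p) \<le> t"
    proof -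
      have "sqrt (2 ^ p) \<le> (2 ^ p :: real)"
        by (rule real_le_lsqrt) (simp_all add: power2_eq_square)
      also have "\<dots> \<le> real n ^ p" using n by (intro power_mono) auto
      also have "\<dots> = exp L" using n by (simp add: L_def exp_of_nat_mult)
      finally have "exp (- w / 4) * sqrt (2 ^ p) \<le> exp (- w / 4) * exp L" by simp
      also have "\<dots> \<le> t"
      proof -
        have "w / 4 = C1 * L + 2 * L" by (simp add: w_def field_simps)
        moreover have "0 \<le> C1 * L" using L C1 by simp
        ultimately show ?thesis unfolding t_def exp_add[symmetric] exp_le_cancel_iff by linarith
      qed
      finally show ?thesis .
    qed
    moreover have "\<delta>1 * (real p / 2 + w) \<le> c * (\<delta>1 * L)"
    proof -
      have "real p / 2 + w \<le> c * L" using pL by (simp add: c_def w_def algebra_simps)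
      from mult_left_mono[OF this \<delta>1(1)] show ?thesis by (simp add: mult_ac)
    qed
    moreover have "\<delta>2 \<le> c * \<delta>2" "2 * t \<le> c * t" using c \<delta>2 t mult_right_mono[of 1 c \<delta>2] by auto
    ultimately show ?thesis by (simp add: distrib_left)
  qed
  then show ?thesis unfolding t(2) by (simp add: \<phi>_def c_def L_def mult.assoc)
qed

end

theorem proposition2p5:
  fixes C1 :: real
  assumes "0 < C1"
  shows "\<exists>c1 c2 :: real. 0 < c1 \<and> 0 < c2 \<and>
    (\<forall>(n::nat) (p::nat) X \<beta>0 r (\<sigma>0::real) N \<pi> S (\<delta>1::real) (\<delta>2::real) (\<delta>3::real).
       2 \<le> n \<longrightarrow>
       linear_model n p X \<beta>0 r \<sigma>0 N \<longrightarrow>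
       prior_density p \<pi> \<longrightarrow> variance_prior n S \<longrightarrow>
       \<delta>1 \<in> {0..<1} \<longrightarrow> \<delta>2 \<in> {0..<1} \<longrightarrow> \<delta>3 \<in> {0..<1} \<longrightarrow>
       \<pi> \<beta>0 \<ge> sqrt (Determinant.det (gram X)) / \<sigma>0 ^ p * real n powr (- (C1 * real p)) \<longrightarrow>
       measure (noise n N)
         {e \<in> space (noise n N).
            measure (variance_posterior X \<pi> S (response X \<beta>0 r e))
              {s. \<bar>s / \<sigma>0\<^sup>2 - 1\<bar> > \<delta>1} \<le> \<delta>2} \<ge> 1 - \<delta>3 \<longrightarrow>
       phi X \<beta>0 \<sigma>0 \<pi> (1 / sqrt (real n)) \<le> 1 / 2 \<longrightarrow>
       (\<forall>y \<in> Hset X \<beta>0 \<sigma>0 \<pi> S \<delta>1 \<delta>2 c1. proper_posterior X \<pi> S y \<longrightarrow>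
          tv_dist (beta_posterior X \<pi> S y)
            (normal_vec (lse X y) (smult_mat (\<sigma>0\<^sup>2) (mat_inv (gram X))))
          \<le> phi X \<beta>0 \<sigma>0 \<pi> (c1 * sqrt (real p * ln (real n)))
            + c1 * (\<delta>1 * real p * ln (real n) + \<delta>2 + real n powr (- (c2 * real p)))))"
proof (rule exI[of _ "4 * C1 + 9"], rule exI[of _ 1], intro conjI allI impI ballI)
  fix n p X \<beta>0 r \<sigma>0 N \<pi> S \<delta>1 \<delta>2 \<delta>3 y
  assume n: "2 \<le> n" and lm: "linear_model n p X \<beta>0 r \<sigma>0 N"
    and \<pi>: "prior_density p \<pi>" and S: "variance_prior n S"
    and \<delta>: "\<delta>1 \<in> {0..<1}" "\<delta>2 \<in> {0..<1}"
    and \<pi>0: "\<pi> \<beta>0 \<ge> sqrt (Determinant.det (gram X)) / \<sigma>0 ^ p * real n powr (- (C1 * real p))"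
    and yH: "y \<in> Hset X \<beta>0 \<sigma>0 \<pi> S \<delta>1 \<delta>2 (4 * C1 + 9)" and proper: "proper_posterior X \<pi> S y"
  interpret gaussian_quasi_posterior n p X \<pi> S y
  proof
    show X: "X \<in> carrier_mat n p" using lm by (simp add: linear_model_def)
    then show "y \<in> carrier_vec n" using yH by (simp add: Hset_def)
  qed (use lm \<pi> S proper in \<open>auto simp: linear_model_def\<close>)
  show "tv_dist (beta_posterior X \<pi> S y)
      (normal_vec (lse X y) (smult_mat (\<sigma>0\<^sup>2) (mat_inv (gram X))))
    \<le> phi X \<beta>0 \<sigma>0 \<pi> ((4 * C1 + 9) * sqrt (real p * ln (real n)))
      + (4 * C1 + 9) * (\<delta>1 * real p * ln (real n) + \<delta>2 + real n powr (- (1 * real p)))"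
    using tv_dist_posterior_normal_log[OF n assms _ _ _ _ _ _ \<pi>0 yH] lm \<delta>
    by (auto simp: linear_model_def bhat_def)
qed (use assms in auto)

end
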